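(* Let $T$ be a reduced linear trellis of length $n$ with span distribution $\mathcal{S}(T)$, and for each $\mathfrak{s}\in\mathcal{S}(T)$ let $m(\mathfrak{s},T)$ be its multiplicity. Let $\boldsymbol{\alpha}^{\mathfrak{s},i}\in\mathbb{F}^n$ ($\mathfrak{s}\in\mathcal{S}(T)$, $1\le i\le m(\mathfrak{s},T)$) be vectors each having span $\mathfrak{s}$. Then $$T\sim\bigotimes_{\mathfrak{s}\in\mathcal{S}(T)}\bigotimes_{i=1}^{m(\mathfrak{s},T)}\boldsymbol{\alpha}^{\mathfrak{s},i}|\mathfrak{s}$$ if and only if for every $\mathfrak{s}\in\mathcal{S}(T)$ $$C_{\mathfrak{s}}(T)=\langle\boldsymbol{\alpha}^{\mathfrak{s},1},\dots,\boldsymbol{\alpha}^{\mathfrak{s},m(\mathfrak{s},T)}\rangle+\sum_{\mathfrak{s}'<\mathfrak{s}}C_{\mathfrak{s}'}(T).$$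
   Context: Let $\mathbb{F}$ be a finite field and $n\ge1$; indices are taken in $\mathbb{Z}_n$. A trellis $T$ of length $n$ over $\mathbb{F}$ consists of pairwise disjoint finite vertex sets $V_i(T)$, $i\in\mathbb{Z}_n$, and edge sets $E_i(T)\subseteq V_i(T)\times\mathbb{F}\times V_{i+1}(T)$; $(v,\alpha,w)\in E_i(T)$ is an edge from $v$ to $w$ with label $\alpha$. Trellises are trim. $T$ is linear if each $V_i(T)$ is an $\mathbb{F}$-vector space and each $E_i(T)$ a subspace. A cycle is a closed path of length $n$ starting in $V_0(T)$, identified with $(\mathbf{v},\boldsymbol{\alpha})\in\prod_iV_i(T)\times\mathbb{F}^n$; $\mathbb{S}(T)$ is the space of cycles, $L(\mathbf{v},\boldsymbol{\alpha})=\boldsymbol{\alpha}$. $T$ is reduced if every edge lies on a cycle. $T\sim T'$ means there are bijections $f_i:V_i(T)\to V_i(T')$ with $(v,\alpha,w)\in E_i(T)\iff(f_i(v),\alpha,f_{i+1}(w))\in E_i(T')$. Spans: for $a\in\mathbb{Z}_n$, $0\le l\le n-1$, $[a,a+l]=\{a,\dots,a+l\}\subseteq\mathbb{Z}_n$, $(a,a+l]=[a,a+l]\setminus\{a\}$; $(a,l)$ is a span; degenerate spans are $\emptyset$ (length $-1$) and $\mathbb{Z}_n$ (length $n$, written $(a,n)$). Partial order: $(a_1,l_1)\le(a_2,l_2)$ iff ($l_1\le l_2<n-1$ and $[a_1,a_1+l_1]\subseteq[a_2,a_2+l_2]$) or ($l_2=n-1$ and $(a_1,a_1+l_1]\subseteq(a_2,a_2+l_2]$)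 or $l_1=-1$ or $l_2=n$; $\mathfrak{s}'<\mathfrak{s}$ means $\mathfrak{s}'\le\mathfrak{s}$, $\mathfrak{s}'\ne\mathfrak{s}$. A vector in $\mathbb{F}^n$ has span $(a,l)$, $0\le l\le n-1$, if its support lies in $[a,a+l]$; $\mathbb{Z}_n$ is a span of every vector. A nondegenerate $(a,l)$ is a span of a cycle $(\mathbf{v},\boldsymbol{\alpha})$ if $\{i:v_i\ne0\}\subseteq(a,a+l]$ and $\{i:\alpha_i\ne0\}\subseteq[a,a+l]$; $\emptyset$ is a span only of the zero cycle and $\mathbb{Z}_n$ of every cycle. $\mathbb{S}_{\mathfrak{s}}(T)$ is the subspace of cycles with span $\mathfrak{s}$ and $C_{\mathfrak{s}}(T):=L(\mathbb{S}_{\mathfrak{s}}(T))$. Elementary trellis $\boldsymbol{\alpha}|(a,l)$ ($\boldsymbol{\alpha}$ of span $(a,l)$, $0\le l\le n$): $V_i=\mathbb{F}$ for $i\in(a,a+l]$ (all $i$ if $l=n$), $V_i=0$ otherwise, $E_i=\langle(u_i,\alpha_i,u_{i+1})\rangle$ with $u_i=1$ if $i\in(a,a+l]$, else $0$. The product $T\otimes T'$ has $V_i=V_i(T)\times V_i(T')$ and $E_i=\{((v,v'),\alpha+\alpha',(w,w')):(v,\alpha,w)\in E_i(T),(v',\alpha',w')\in E_i(T')\}$. An elementary trellis factorization of $T$ is an expression $T\sim\bigotimes_{i=1}^r\boldsymbol{\alpha}^i|(a_i,l_i)$ with at most one factor of span $(a,0)$ for each $a$. Every reduced linear trellis has one,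 and all have the same multiset of spans, the span distribution $\mathcal{S}(T)$. *)

theory Defs
  imports Main HOL.Vector_Spaces "HOL-Library.Multiset"
begin

text \<open>Indices of Z_n are represented by naturals i < n, successor is (Suc i) mod n.
  Vectors of F^n are functions nat => 'a that vanish from index n on.\<close>

record ('v, 'a) trellis =
  verts :: "nat \<Rightarrow> 'v set"
  edges :: "nat \<Rightarrow> ('v \<times> 'a \<times> 'v) set"

definition nxt :: "nat \<Rightarrow> nat \<Rightarrow> nat" where
  "nxt n i = Suc i mod n"

definition prv :: "nat \<Rightarrow> nat \<Rightarrow> nat" where
  "prv n i = (i + n - 1) mod n"

definition is_trellis :: "nat \<Rightarrow> ('v, 'a) trellis \<Rightarrow> bool" where
  "is_trellis n T \<longleftrightarrow> n \<ge> 1 \<and>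
     (\<forall>i<n. finite (verts T i)) \<and>
     (\<forall>i<n. edges T i \<subseteq> verts T i \<times> UNIV \<times> verts T (nxt n i)) \<and>
     (\<forall>i<n. \<forall>v\<in>verts T i. (\<exists>a w. (v, a, w) \<in> edges T i) \<and>
                            (\<exists>u a. (u, a, v) \<in> edges T (prv n i)))"

definition linear_trellis ::
  "nat \<Rightarrow> ('a::field \<Rightarrow> 'v::ab_group_add \<Rightarrow> 'v) \<Rightarrow> ('v, 'a) trellis \<Rightarrow> bool" where
  "linear_trellis n scale T \<longleftrightarrow> vector_space scale \<and>
     (\<forall>i<n. 0 \<in> verts T i \<and>
        (\<forall>x\<in>verts T i. \<forall>y\<in>verts T i. x + y \<in> verts T i) \<and>
        (\<forall>c. \<forall>x\<in>verts T i. scale c x \<in> verts T i)) \<and>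
     (\<forall>i<n. (0, 0, 0) \<in> edges T i \<and>
        (\<forall>(v, a, w)\<in>edges T i. \<forall>(v', a', w')\<in>edges T i.
            (v + v', a + a', w + w') \<in> edges T i) \<and>
        (\<forall>c. \<forall>(v, a, w)\<in>edges T i. (scale c v, c * a, scale c w) \<in> edges T i))"

definition cycles :: "nat \<Rightarrow> ('v::zero, 'a::zero) trellis \<Rightarrow> ((nat \<Rightarrow> 'v) \<times> (nat \<Rightarrow> 'a)) set" where
  "cycles n T = {(v, a). (\<forall>k\<ge>n. v k = 0 \<and> a k = 0) \<and>
                         (\<forall>i<n. (v i, a i, v (nxt n i)) \<in> edges T i)}"

definition reduced :: "nat \<Rightarrow> ('v::zero, 'a::zero) trellis \<Rightarrow> bool" where
  "reduced n T \<longleftrightarrow> (\<forall>i<n. \<forall>e\<in>edges T i. \<exists>(v, a)\<in>cycles n T. (v i, a i, v (nxt n i)) = e)"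

text \<open>Spans: Emp is the empty span (length -1), Full is Z_n (length n),
  Sp a l is the span (a,l) with a < n and 0 \<le> l \<le> n-1.\<close>
datatype span = Emp | Full | Sp nat nat

definition valid_span :: "nat \<Rightarrow> span \<Rightarrow> bool" where
  "valid_span n s = (case s of Sp a l \<Rightarrow> a < n \<and> l < n | _ \<Rightarrow> True)"

definition icc :: "nat \<Rightarrow> nat \<Rightarrow> nat \<Rightarrow> nat set" where
  "icc n a l = {(a + k) mod n | k. k \<le> l}"

definition ioc :: "nat \<Rightarrow> nat \<Rightarrow> nat \<Rightarrow> nat set" where
  "ioc n a l = {(a + k) mod n | k. 1 \<le> k \<and> k \<le> l}"

definition span_le :: "nat \<Rightarrow> span \<Rightarrow> span \<Rightarrow> bool" where
  "span_le n s1 s2 = (case (s1, s2) of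
      (Emp, _) \<Rightarrow> True
    | (_, Full) \<Rightarrow> True
    | (Sp a1 l1, Sp a2 l2) \<Rightarrow>
        (l1 \<le> l2 \<and> l2 < n - 1 \<and> icc n a1 l1 \<subseteq> icc n a2 l2) \<or>
        (l2 = n - 1 \<and> ioc n a1 l1 \<subseteq> ioc n a2 l2)
    | _ \<Rightarrow> False)"

definition span_less :: "nat \<Rightarrow> span \<Rightarrow> span \<Rightarrow> bool" where
  "span_less n s1 s2 \<longleftrightarrow> span_le n s1 s2 \<and> s1 \<noteq> s2"

definition is_vec :: "nat \<Rightarrow> (nat \<Rightarrow> 'a::zero) \<Rightarrow> bool" where
  "is_vec n x \<longleftrightarrow> (\<forall>k\<ge>n. x k = 0)"

definition vec_has_span :: "nat \<Rightarrow> span \<Rightarrow> (nat \<Rightarrow> 'a::zero) \<Rightarrow> bool" where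
  "vec_has_span n s x = (case s of
      Emp \<Rightarrow> (\<forall>i<n. x i = 0)
    | Full \<Rightarrow> True
    | Sp a l \<Rightarrow> (\<forall>i<n. x i \<noteq> 0 \<longrightarrow> i \<in> icc n a l))"

definition cycle_has_span ::
  "nat \<Rightarrow> span \<Rightarrow> (nat \<Rightarrow> 'v::zero) \<times> (nat \<Rightarrow> 'a::zero) \<Rightarrow> bool" where
  "cycle_has_span n s c = (case c of (v, x) \<Rightarrow> (case s of
      Emp \<Rightarrow> (\<forall>i<n. v i = 0 \<and> x i = 0)
    | Full \<Rightarrow> True
    | Sp a l \<Rightarrow> (\<forall>i<n. (v i \<noteq> 0 \<longrightarrow> i \<in> ioc n a l) \<and> (x i \<noteq> 0 \<longrightarrow> i \<in> icc n a l))))"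

definition Cspan :: "nat \<Rightarrow> ('v::zero, 'a::zero) trellis \<Rightarrow> span \<Rightarrow> (nat \<Rightarrow> 'a) set" where
  "Cspan n T s = snd ` {c \<in> cycles n T. cycle_has_span n s c}"

definition active :: "nat \<Rightarrow> span \<Rightarrow> nat set" where
  "active n s = (case s of Emp \<Rightarrow> {} | Full \<Rightarrow> UNIV | Sp a l \<Rightarrow> ioc n a l)"

definition elem_trellis :: "nat \<Rightarrow> (nat \<Rightarrow> 'a::field) \<Rightarrow> span \<Rightarrow> ('a, 'a) trellis" where
  "elem_trellis n x s =
     (let u = (\<lambda>i. if i \<in> active n s then 1 else 0) in
      \<lparr> verts = (\<lambda>i. if i \<in> active n s then UNIV else {0}),
        edges = (\<lambda>i. {(c * u i, c * x i, c * u (nxt n i)) | c. True}) \<rparr>)"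

fun elem_prod :: "nat \<Rightarrow> ((nat \<Rightarrow> 'a::field) \<times> span) list \<Rightarrow> ('a list, 'a) trellis" where
  "elem_prod n [] = \<lparr> verts = (\<lambda>i. {[]}), edges = (\<lambda>i. {([], 0, [])}) \<rparr>"
| "elem_prod n ((x, s) # fs) =
     (let T1 = elem_trellis n x s; T2 = elem_prod n fs in
      \<lparr> verts = (\<lambda>i. {v # vs | v vs. v \<in> verts T1 i \<and> vs \<in> verts T2 i}),
        edges = (\<lambda>i. {(v # vs, a + b, w # ws) | v vs a b w ws.
                        (v, a, w) \<in> edges T1 i \<and> (vs, b, ws) \<in> edges T2 i}) \<rparr>)"

text \<open>Product of a multiset of elementary trellises (well defined up to equivalence).\<close>
definition elem_prod_mset :: "nat \<Rightarrow> ((nat \<Rightarrow> 'a::field) \<times> span) multiset \<Rightarrow> ('a list, 'a) trellis" where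
  "elem_prod_mset n M = elem_prod n (SOME fs. mset fs = M)"

definition trellis_equiv :: "nat \<Rightarrow> ('v, 'a) trellis \<Rightarrow> ('w, 'a) trellis \<Rightarrow> bool" where
  "trellis_equiv n T T' \<longleftrightarrow> (\<exists>f :: nat \<Rightarrow> 'v \<Rightarrow> 'w.
     (\<forall>i<n. bij_betw (f i) (verts T i) (verts T' i)) \<and>
     (\<forall>i<n. \<forall>v\<in>verts T i. \<forall>w\<in>verts T (nxt n i). \<forall>a.
        (v, a, w) \<in> edges T i \<longleftrightarrow> (f i v, a, f (nxt n i) w) \<in> edges T' i))"

definition is_elem_factorization ::
  "nat \<Rightarrow> ('v, 'a::field) trellis \<Rightarrow> ((nat \<Rightarrow> 'a) \<times> span) list \<Rightarrow> bool" where
  "is_elem_factorization n T fs \<longleftrightarrow>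
     (\<forall>(x, s)\<in>set fs. s \<noteq> Emp \<and> valid_span n s \<and> is_vec n x \<and> vec_has_span n s x) \<and>
     (\<forall>a<n. length (filter (\<lambda>(x, s). s = Sp a 0) fs) \<le> 1) \<and>
     trellis_equiv n T (elem_prod n fs)"

text \<open>Span distribution (the multiset of spans of any elementary trellis factorization).\<close>
definition span_distribution :: "nat \<Rightarrow> ('v, 'a::field) trellis \<Rightarrow> span multiset" where
  "span_distribution n T =
     (SOME M. \<exists>fs. is_elem_factorization n T fs \<and> M = mset (map snd fs))"

definition gen_space :: "nat \<Rightarrow> (nat \<Rightarrow> nat \<Rightarrow> 'a::field) \<Rightarrow> (nat \<Rightarrow> 'a) set" where
  "gen_space m x = {(\<lambda>k. \<Sum>j\<in>{1..m}. c j * x j k) | c. True}"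

definition lower_sum :: "nat \<Rightarrow> ('v::zero, 'a::field) trellis \<Rightarrow> span \<Rightarrow> (nat \<Rightarrow> 'a) set" where
  "lower_sum n T s =
     {(\<lambda>k. \<Sum>s'\<in>{s'. valid_span n s' \<and> span_less n s' s}. y s' k) | y.
        \<forall>s'. valid_span n s' \<and> span_less n s' s \<longrightarrow> y s' \<in> Cspan n T s'}"

definition set_plus_vec :: "(nat \<Rightarrow> 'a::plus) set \<Rightarrow> (nat \<Rightarrow> 'a) set \<Rightarrow> (nat \<Rightarrow> 'a) set" where
  "set_plus_vec A B = {(\<lambda>k. x k + y k) | x y. x \<in> A \<and> y \<in> B}"

end

theory Submission
  imports Defs "HOL-Library.Function_Algebras" "HOL-Library.Product_Plus"
    "HOL-Combinatorics.Permutations"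
begin

text \<open>Existence of a factorization: if a cycle of span \<open>s = (a, l)\<close> is a sum of cycles whose spans
  are not above \<open>s\<close>, then each summand has a zero vertex inside the arc of \<open>s\<close> (or vanishes on it)
  and can be cut there, so the cycle is a sum of cycles of spans \<open>(a, l - 1)\<close> and
  \<open>(a + 1, l - 1)\<close>. Hence extending bases span by span gives a basis of the cycle space that is
  adapted to all spaces of cycles of given span, and the label vectors of this basis factor \<open>T\<close>.

  The spaces \<open>C\<^sub>s\<close> are invariant under equivalence, and for a product of elementary trellises
  \<open>C\<^sub>s\<close> is generated by the vectors whose span is at most \<open>s\<close>; this gives one direction.
  Conversely, replacing one vector by a combination of vectors of smaller or equal span, with
  nonzero coefficient at the replaced one, is an equivalence. A Steinitz exchange by such
  replacements turns any factorization into the prescribed one.\<close>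

section \<open>Spans\<close>

text \<open>The obstacle is that the label map need not be injective on cycles: a nonzero cycle can
  have zero labels, so the label vectors of a factorization may be dependent or even equal, and the
  spaces \<open>C\<^sub>s\<close> do not determine the dimensions of the spaces of cycles. Bases are
  available only on the side of cycles, for existence. The exchange has to work with indexed
  families of vectors and with expansions that are not unique. It succeeds because both families
  have the same number of vectors for each span: a prescribed vector that seems to involve no
  unmatched old vector forces a linear relation among the old vectors, and adding this relation to
  its expansion produces the nonzero coefficient.

  Two extreme kinds of span shape the details. A factor of span \<open>(a, 0)\<close> has no active
  vertex and shows only in the label at \<open>a\<close>. The span \<open>(a, n - 1)\<close> allows
  every label and every vertex except the one at \<open>a\<close>; it singles out the cycles through
  the zero vertex at \<open>a\<close>, and this is what makes coordinates of vertices
  unique.\<close>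

definition lab :: "nat \<Rightarrow> span \<Rightarrow> nat set" where
  "lab n s = (case s of Emp \<Rightarrow> {} | Full \<Rightarrow> UNIV | Sp a l \<Rightarrow> icc n a l)"

lemma lab_simps [simp]:
  "lab n Emp = {}" "lab n Full = UNIV" "lab n (Sp a l) = icc n a l"
  by (simp_all add: lab_def)

lemma active_simps [simp]:
  "active n Emp = {}" "active n Full = UNIV" "active n (Sp a l) = ioc n a l"
  by (simp_all add: active_def)

lemma valid_span_simps [simp]:
  "valid_span n Emp" "valid_span n Full" "valid_span n (Sp a l) \<longleftrightarrow> a < n \<and> l < n"
  by (simp_all add: valid_span_def)

lemma cycle_has_span_iff:
  "cycle_has_span n s c \<longleftrightarrow>
     (\<forall>i<n. (fst c i \<noteq> 0 \<longrightarrow> i \<in> active n s) \<and> (snd c i \<noteq> 0 \<longrightarrow> i \<in> lab n s))"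
  by (cases c; cases s) (auto simp: cycle_has_span_def)

lemma vec_has_span_iff:
  "vec_has_span n s x \<longleftrightarrow> (\<forall>i<n. x i \<noteq> 0 \<longrightarrow> i \<in> lab n s)"
  by (cases s) (auto simp: vec_has_span_def)

lemma icc_image: "icc n a l = (\<lambda>k. (a + k) mod n) ` {..l}"
  by (auto simp: icc_def)

lemma ioc_image: "ioc n a l = (\<lambda>k. (a + k) mod n) ` {1..l}"
  by (auto simp: ioc_def)

lemma inj_on_shift_mod: "inj_on (\<lambda>k. (a + k) mod n) {..<n::nat}"
proof (rule linorder_inj_onI)
  fix k k' :: nat
  assume "k < k'" "k \<in> {..<n}" "k' \<in> {..<n}"
  show "(a + k) mod n \<noteq> (a + k') mod n"
  proof
    assume "(a + k) mod n = (a + k') mod n"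
    then have "n dvd (a + k') - (a + k)"
      using \<open>k < k'\<close> by (metis mod_eq_dvd_iff_nat add_left_mono less_imp_le)
    then have "n dvd k' - k" by simp
    with \<open>k < k'\<close> \<open>k' \<in> _\<close> show False by (auto dest: dvd_imp_le)
  qed
qed auto

lemma shift_mod_surj:
  fixes i n a :: nat
  assumes "i < n" "a < n"
  obtains k where "k < n" "i = (a + k) mod n"
proof
  show "(i + n - a) mod n < n" using assms by simp
  show "i = (a + (i + n - a) mod n) mod n"
    using assms by (simp add: mod_add_right_eq)
qed

lemma card_icc: "l < n \<Longrightarrow> card (icc n a l) = Suc l"
  unfolding icc_image by (subst card_image) (auto intro: inj_on_subset[OF inj_on_shift_mod])

lemma card_ioc: "l < n \<Longrightarrow> card (ioc n a l) = l"
  unfolding ioc_image by (subst card_image) (auto intro: inj_on_subset[OF inj_on_shift_mod])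

lemma icc_lessThan: "0 < n \<Longrightarrow> icc n a l \<subseteq> {..<n}"
  by (auto simp: icc_def)

lemma ioc_subset_icc: "ioc n a l \<subseteq> icc n a l"
  by (auto simp: icc_def ioc_def)

lemma finite_icc: "finite (icc n a l)" by (simp add: icc_image)

lemma icc_full: "0 < n \<Longrightarrow> icc n a (n - 1) = {..<n}"
  by (rule card_subset_eq) (auto simp: card_icc dest: icc_lessThan[THEN subsetD])

lemma icc_eq_insert: "a < n \<Longrightarrow> icc n a l = insert a (ioc n a l)"
proof -
  assume "a < n"
  have "{..l} = insert 0 {1..l}" by auto
  then show ?thesis using \<open>a < n\<close> by (simp add: icc_image ioc_image)
qed

lemma start_notin_ioc: "a < n \<Longrightarrow> l < n \<Longrightarrow> a \<notin> ioc n a l"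
  using card_icc[of l n a] card_ioc[of l n a] icc_eq_insert[of a n l] by (auto simp: insert_absorb)

lemma nxt_less: "0 < n \<Longrightarrow> nxt n i < n"
  by (simp add: nxt_def)

lemma nxt_shift: "nxt n ((a + k) mod n) = (a + Suc k) mod n"
  by (simp add: nxt_def mod_Suc_eq)

lemma nxt_inj: "i < n \<Longrightarrow> j < n \<Longrightarrow> nxt n i = nxt n j \<Longrightarrow> i = j"
  by (auto simp: nxt_def mod_Suc split: if_splits)

lemma active_subset_lab: "active n s \<subseteq> lab n s"
  by (cases s) (auto simp: ioc_subset_icc)

lemma nxt_active_lab:
  assumes "i < n" "nxt n i \<in> active n s"
  shows "i \<in> lab n s"
proof (cases s)
  case (Sp a l)
  then obtain k where k: "1 \<le> k" "k \<le> l" "nxt n i = (a + k) mod n"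
    using assms by (auto simp: ioc_def)
  then have "nxt n i = nxt n ((a + (k - 1)) mod n)"
    using nxt_shift[of n a "k - 1"] by simp
  with assms have "i = (a + (k - 1)) mod n"
    by (intro nxt_inj[of i n]) auto
  with k Sp show ?thesis by (auto simp: icc_def intro!: exI[of _ "k - 1"])
qed (use assms in auto)

text \<open>Meant for local coefficients \<open>g\<close>: every edge of a cycle in a product
  carries its own coefficient of a given factor, and two consecutive edges agree if the vertex
  between them is active. The \<open>l + 1\<close> labels of \<open>(a, l)\<close> are linked by its
  \<open>l\<close> active vertices; on the full circle the links from 0 up to \<open>n - 1\<close>
  suffice.\<close>

lemma arc_constant:
  assumes "0 < n" "\<And>i. i < n \<Longrightarrow> nxt n i \<in> active n s \<Longrightarrow> g i = g (nxt n i)"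
  shows "\<exists>c. \<forall>i<n. i \<in> lab n s \<longrightarrow> g i = c"
proof (cases s)
  case Full
  have "k < n \<Longrightarrow> g k = g 0" for k
  proof (induction k)
    case (Suc k)
    then have "nxt n k = Suc k" by (simp add: nxt_def)
    with Suc assms(2)[of k] Full show ?case by simp
  qed simp
  then show ?thesis by blast
next
  case (Sp a l)
  have "k \<le> l \<Longrightarrow> g ((a + k) mod n) = g (a mod n)" for k
  proof (induction k)
    case (Suc k)
    have "nxt n ((a + k) mod n) \<in> active n s"
      using Suc.prems by (auto simp: Sp nxt_shift ioc_def intro!: exI[of _ "Suc k"])
    then have "g ((a + k) mod n) = g ((a + Suc k) mod n)"
      using assms by (metis nxt_shift mod_less_divisor)
    with Suc show ?case by simp
  qed simp
  then have "\<forall>i<n. i \<in> lab n s \<longrightarrow> g i = g (a mod n)"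
    by (auto simp: Sp icc_def)
  then show ?thesis by blast
qed auto

text \<open>A point of the inner half-open arc is the successor of a point of the outer closed arc,
  say at position \<open>m\<close>. As \<open>l2 < n - 1\<close>, the positions
  \<open>0, ..., l2 + 1\<close> are distinct indices, so the successor cannot leave the outer arc
  and come back at its start. For \<open>l2 = n - 1\<close> this wrap-around does occur.\<close>

lemma ioc_mono_of_icc:
  assumes "a2 < n" "l2 < n - 1" "icc n a1 l1 \<subseteq> icc n a2 l2"
  shows "ioc n a1 l1 \<subseteq> ioc n a2 l2"
proof
  fix i assume "i \<in> ioc n a1 l1"
  then obtain k where k: "1 \<le> k" "k \<le> l1" "i = (a1 + k) mod n" by (auto simp: ioc_def)
  let ?p = "(a1 + (k - 1)) mod n"
  have ip: "i = nxt n ?p" using k nxt_shift[of n a1 "k - 1"] by simp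
  have "?p \<in> icc n a1 l1" using k by (auto simp: icc_def intro!: exI[of _ "k - 1"])
  then have "?p \<in> icc n a2 l2" using assms by auto
  then obtain m where m: "m \<le> l2" "?p = (a2 + m) mod n" by (auto simp: icc_def)
  have i: "i = (a2 + Suc m) mod n" using ip m nxt_shift[of n a2 m] by simp
  have "i \<in> icc n a2 l2" using k assms(3) by (auto simp: icc_def)
  then obtain m' where m': "m' \<le> l2" "i = (a2 + m') mod n" by (auto simp: icc_def)
  have "Suc m = m'"
    by (rule inj_onD[OF inj_on_shift_mod[of a2 n]]) (use i m' m assms(2) in auto)
  then show "i \<in> ioc n a2 l2" using m' by (auto simp: ioc_def intro!: exI[of _ "Suc m"])
qed

text \<open>This explains the two cases of the order. Below length \<open>n - 1\<close> inclusion of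
  closed arcs forces inclusion of half-open ones; at length \<open>n - 1\<close> the closed arc is
  everything and only the half-open arc remembers the starting point.\<close>

lemma span_le_iff:
  assumes "0 < n" "valid_span n s1" "valid_span n s2"
  shows "span_le n s1 s2 \<longleftrightarrow> active n s1 \<subseteq> active n s2 \<and> lab n s1 \<subseteq> lab n s2"
proof -
  have nonempty: "icc n a l \<noteq> {}" for a l by (auto simp: icc_def)
  \<comment> \<open>\<open>Full\<close> is encoded by the infinite set \<open>UNIV\<close>, so it
    stays strictly above \<open>Sp a (n - 1)\<close>, although both allow a label at each index
    below \<open>n\<close>.\<close>
  have nonfull: "\<not> UNIV \<subseteq> icc n a l" for a l
    using finite_icc[of n a l] by (metis infinite_UNIV_nat top.extremum_uniqueI)
  show ?thesis
  proof (cases s1; cases s2)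
    fix a1 l1 a2 l2 assume s: "s1 = Sp a1 l1" "s2 = Sp a2 l2"
    show ?thesis
    proof (cases "l2 = n - 1")
      case True
      then have "icc n a1 l1 \<subseteq> icc n a2 l2"
        using icc_full[OF assms(1), of a2] icc_lessThan[OF assms(1), of a1 l1] by simp
      then show ?thesis using True s assms by (auto simp: span_le_def)
    next
      case False
      then have l2: "l2 < n - 1" using s assms by auto
      have "l1 \<le> l2" if "icc n a1 l1 \<subseteq> icc n a2 l2"
        using card_mono[OF finite_icc that] s assms by (simp add: card_icc)
      then show ?thesis using s assms l2 ioc_mono_of_icc[of a2 n l2 a1 l1]
        by (auto simp: span_le_def)
    qed
  qed (use nonempty nonfull in \<open>auto simp: span_le_def\<close>)
qed

lemma span_le_trans:
  assumes "0 < n" "valid_span n s1" "valid_span n s2" "valid_span n s3"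
    and "span_le n s1 s2" "span_le n s2 s3"
  shows "span_le n s1 s3"
  using assms by (auto simp: span_le_iff)

lemma span_le_refl: "0 < n \<Longrightarrow> valid_span n s \<Longrightarrow> span_le n s s"
  by (simp add: span_le_iff)

text \<open>The length of the span plus one, which turns the length -1 of \<open>Emp\<close> into a
  natural number.\<close>

fun span_rank :: "nat \<Rightarrow> span \<Rightarrow> nat" where
  "span_rank n Emp = 0" | "span_rank n Full = Suc n" | "span_rank n (Sp a l) = Suc l"

text \<open>For equal lengths, cardinalities turn both inclusions of arcs into equalities, and the
  start is recovered as the only point of the closed arc outside the half-open one. This also works
  for length \<open>n - 1\<close>.\<close>

lemma span_less_rank:
  assumes "0 < n" "valid_span n s1" "valid_span n s2" "span_less n s1 s2"
  shows "span_rank n s1 < span_rank n s2"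
proof (cases s1; cases s2)
  fix a1 l1 a2 l2 assume s: "s1 = Sp a1 l1" "s2 = Sp a2 l2"
  have sub: "ioc n a1 l1 \<subseteq> ioc n a2 l2" "icc n a1 l1 \<subseteq> icc n a2 l2"
    and ne: "\<not> (a1 = a2 \<and> l1 = l2)"
    using assms s by (auto simp: span_less_def span_le_iff)
  have le: "l1 \<le> l2"
    using card_mono[OF finite_icc sub(2)] s assms by (simp add: card_icc)
  have "l1 \<noteq> l2"
  proof
    assume l: "l1 = l2"
    have fin: "finite (ioc n a2 l2)" by (simp add: ioc_image)
    have "ioc n a1 l1 = ioc n a2 l2"
      using l s assms by (intro card_subset_eq[OF fin sub(1)]) (simp add: card_ioc)
    moreover have "icc n a1 l1 = icc n a2 l2"
      using l s assms by (intro card_subset_eq[OF finite_icc sub(2)]) (simp add: card_icc)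
    ultimately have "a1 = a2"
      using icc_eq_insert[of a1 n l1] icc_eq_insert[of a2 n l2]
        start_notin_ioc[of a1 n l1] start_notin_ioc[of a2 n l2] s assms by auto
    with l ne show False by simp
  qed
  with le s show ?thesis by simp
qed (use assms in \<open>auto simp: span_less_def span_le_def\<close>)

lemma span_less_le_trans:
  assumes "0 < n" "valid_span n s1" "valid_span n s2" "valid_span n s3"
    and "span_less n s1 s2" "span_le n s2 s3"
  shows "span_less n s1 s3"
proof -
  have "span_le n s1 s3" using assms span_le_trans unfolding span_less_def by blast
  moreover have "s1 \<noteq> s3"
  proof
    assume "s1 = s3"
    then have "s2 = s1 \<or> span_less n s2 s1" using assms by (auto simp: span_less_def)
    then show False using assms span_less_rank[of n s1 s2] span_less_rank[of n s2 s1]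
      by (auto simp: span_less_def)
  qed
  ultimately show ?thesis by (simp add: span_less_def)
qed

lemma finite_valid_spans: "finite {s. valid_span n s}"
proof -
  have "{s. valid_span n s} \<subseteq> {Emp, Full} \<union> (\<lambda>(a, l). Sp a l) ` ({..<n} \<times> {..<n})"
  proof
    fix s assume "s \<in> {s. valid_span n s}"
    then show "s \<in> {Emp, Full} \<union> (\<lambda>(a, l). Sp a l) ` ({..<n} \<times> {..<n})"
      by (cases s) auto
  qed
  then show ?thesis by (rule finite_subset) auto
qed

text \<open>Once there is an active vertex, the vertices alone decide the order: the closed arc only
  adds the start \<open>a\<close>, and the edge from \<open>a\<close> enters the active vertex
  \<open>nxt n a\<close>, so its label is allowed by \<open>t\<close> as well.\<close>

lemma span_le_of_active:
  assumes "0 < n" "valid_span n s" "valid_span n t" "active n s \<noteq> {}"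
    and sub: "\<And>i. i < n \<Longrightarrow> i \<in> active n s \<Longrightarrow> i \<in> active n t"
  shows "span_le n s t"
proof (cases s; cases t)
  fix a b l m assume s: "s = Sp a l" "t = Sp b m"
  have sub': "ioc n a l \<subseteq> ioc n b m"
    using sub s ioc_subset_icc[of n a l] icc_lessThan[OF assms(1), of a l] by auto
  have "l \<noteq> 0" using assms(4) s by (auto simp: ioc_def)
  then have "nxt n a \<in> ioc n a l"
    by (auto simp: ioc_def nxt_def intro!: exI[of _ 1])
  then have "a \<in> icc n b m" using nxt_active_lab[of a n "Sp b m"] sub' s assms by auto
  then show ?thesis using assms s sub' ioc_subset_icc[of n b m]
    by (auto simp: span_le_iff icc_eq_insert[of a])
next
  fix a l assume s: "s = Full" "t = Sp a l"
  have "a \<in> ioc n a l" using sub[of a] assms s by auto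
  then show ?thesis using start_notin_ioc[of a n l] s assms by auto
next
  fix a l assume s: "s = Sp a l" "t = Emp"
  then have "ioc n a l \<subseteq> {..<n}"
    using ioc_subset_icc[of n a l] icc_lessThan[of n a l] assms(1) by blast
  then show ?thesis using sub s assms(4) by auto
qed (use assms in \<open>auto simp: span_le_def\<close>)

text \<open>These spans are the ones that leave no trace in the vertices of a cycle, so arguments
  that read coefficients off vertices must treat them apart.\<close>

lemma active_empty_imp:
  assumes "valid_span n s" "s \<noteq> Emp" "active n s = {}"
  obtains a where "s = Sp a 0"
proof (cases s)
  case (Sp a l)
  have "card (ioc n a l) = 0" using assms Sp by simp
  moreover have "card (ioc n a l) = l" using Sp assms(1) by (intro card_ioc) simp
  ultimately show ?thesis using that Sp by simp
qed (use assms in auto)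

section \<open>Products of elementary trellises\<close>

lemma sum_fun_apply: "(\<Sum>j\<in>J. f j) k = (\<Sum>j\<in>J. f j k)"
  by (induction J rule: infinite_finite_induct) simp_all

text \<open>Formulated for an indexed family, because different factors may have the same label
  vector.\<close>

lemma (in vector_space) span_image_finite:
  assumes "finite J"
  shows "span (f ` J) = range (\<lambda>c. \<Sum>j\<in>J. scale (c j) (f j))"
proof
  show "range (\<lambda>c. \<Sum>j\<in>J. scale (c j) (f j)) \<subseteq> span (f ` J)"
    by (auto intro!: span_sum intro: span_scale span_base)
  show "span (f ` J) \<subseteq> range (\<lambda>c. \<Sum>j\<in>J. scale (c j) (f j))"
    using assms
  proof (induction J rule: finite_induct)
    case (insert a J)
    show ?case
    proof
      fix y assume "y \<in> span (f ` insert a J)"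
      then obtain k where "y - scale k (f a) \<in> span (f ` J)"
        by (auto simp: span_breakdown_eq)
      then obtain c where c: "y - scale k (f a) = (\<Sum>j\<in>J. scale (c j) (f j))"
        using insert.IH by blast
      have "(\<Sum>j\<in>J. scale ((c(a := k)) j) (f j)) = (\<Sum>j\<in>J. scale (c j) (f j))"
        using insert.hyps by (intro sum.cong) auto
      then have "y = (\<Sum>j\<in>insert a J. scale ((c(a := k)) j) (f j))"
        using c insert.hyps by (simp add: algebra_simps)
      then show "y \<in> range (\<lambda>c. \<Sum>j\<in>insert a J. scale (c j) (f j))" by blast
    qed
  qed simp
qed

text \<open>The index type is left open: the same space serves for label vectors, indexed by
  positions, and for vertices of a product, indexed by factors.\<close>

definition vscale :: "'a::field \<Rightarrow> ('i \<Rightarrow> 'a) \<Rightarrow> 'i \<Rightarrow> 'a" where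
  "vscale c x = (\<lambda>k. c * x k)"

lemma vscale_apply [simp]: "vscale c x k = c * x k"
  by (simp add: vscale_def)

interpretation vec: vector_space "vscale :: 'a::field \<Rightarrow> ('i \<Rightarrow> 'a) \<Rightarrow> 'i \<Rightarrow> 'a"
  by unfold_locales (auto simp: fun_eq_iff algebra_simps)

lemma vec_span_image_finite:
  assumes "finite J"
  shows "vec.span (x ` J) = range (\<lambda>c k. \<Sum>j\<in>J. c j * x j k)"
proof -
  have "(\<Sum>j\<in>J. vscale (c j) (x j)) = (\<lambda>k. \<Sum>j\<in>J. c j * x j k)" for c
    by (simp add: fun_eq_iff sum_fun_apply)
  then show ?thesis by (simp add: vec.span_image_finite[OF assms])
qed

section \<open>Equivalence of trellises and invariance of the spaces
  \<open>C\<^sub>s\<close>\<close>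

lemma trellis_equiv_sym:
  assumes "0 < n" "trellis_equiv n T T'"
  shows "trellis_equiv n T' T"
proof -
  obtain f where f: "\<And>i. i < n \<Longrightarrow> bij_betw (f i) (verts T i) (verts T' i)"
    and e: "\<And>i v w a. i < n \<Longrightarrow> v \<in> verts T i \<Longrightarrow> w \<in> verts T (nxt n i) \<Longrightarrow>
        (v, a, w) \<in> edges T i \<longleftrightarrow> (f i v, a, f (nxt n i) w) \<in> edges T' i"
    using assms(2) unfolding trellis_equiv_def by blast
  define g where "g i = inv_into (verts T i) (f i)" for i
  have g: "bij_betw (g i) (verts T' i) (verts T i)" if "i < n" for i
    using f[OF that] by (simp add: g_def bij_betw_inv_into)
  have fg: "f i (g i v) = v" if "i < n" "v \<in> verts T' i" for i v
    using f[OF that(1)] that(2) by (simp add: g_def bij_betw_inv_into_right)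
  have "(v, a, w) \<in> edges T' i \<longleftrightarrow> (g i v, a, g (nxt n i) w) \<in> edges T i"
    if "i < n" "v \<in> verts T' i" "w \<in> verts T' (nxt n i)" for i v w a
    using e[OF that(1), of "g i v" "g (nxt n i) w" a] g[THEN bij_betwE] that
      nxt_less[OF assms(1), of i] by (simp add: fg)
  with g show ?thesis unfolding trellis_equiv_def by blast
qed

lemma trellis_equiv_trans:
  assumes "0 < n" "trellis_equiv n T T'" "trellis_equiv n T' T''"
  shows "trellis_equiv n T T''"
proof -
  obtain f where f: "\<And>i. i < n \<Longrightarrow> bij_betw (f i) (verts T i) (verts T' i)"
    and e: "\<And>i v w a. i < n \<Longrightarrow> v \<in> verts T i \<Longrightarrow> w \<in> verts T (nxt n i) \<Longrightarrow>
        (v, a, w) \<in> edges T i \<longleftrightarrow> (f i v, a, f (nxt n i) w) \<in> edges T' i"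
    using assms(2) unfolding trellis_equiv_def by blast
  obtain g where g: "\<And>i. i < n \<Longrightarrow> bij_betw (g i) (verts T' i) (verts T'' i)"
    and e': "\<And>i v w a. i < n \<Longrightarrow> v \<in> verts T' i \<Longrightarrow> w \<in> verts T' (nxt n i) \<Longrightarrow>
        (v, a, w) \<in> edges T' i \<longleftrightarrow> (g i v, a, g (nxt n i) w) \<in> edges T'' i"
    using assms(3) unfolding trellis_equiv_def by blast
  have "bij_betw (g i \<circ> f i) (verts T i) (verts T'' i)" if "i < n" for i
    using f g that bij_betw_trans by blast
  moreover have "(v, a, w) \<in> edges T i \<longleftrightarrow>
      ((g i \<circ> f i) v, a, (g (nxt n i) \<circ> f (nxt n i)) w) \<in> edges T'' i"
    if "i < n" "v \<in> verts T i" "w \<in> verts T (nxt n i)" for i v w a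
    using e[OF that] e'[of i "f i v" "f (nxt n i) w" a] f[THEN bij_betwE] that
      nxt_less[OF assms(1), of i] by simp
  ultimately show ?thesis unfolding trellis_equiv_def
    by (intro exI[of _ "\<lambda>i. g i \<circ> f i"]) blast
qed

text \<open>An equivalence need not be linear, but translating it by the image of the zero cycle
  makes it map zero vertices to zero vertices.\<close>

lemma Cspan_subset_of_equiv:
  fixes T :: "('v::ab_group_add, 'a::field) trellis" and T' :: "('w::ab_group_add, 'a) trellis"
  assumes "0 < n" and lin: "linear_trellis n scale T" and lin': "linear_trellis n scale' T'"
    and wf: "\<And>i. i < n \<Longrightarrow> edges T i \<subseteq> verts T i \<times> UNIV \<times> verts T (nxt n i)"
    and eq: "trellis_equiv n T T'"
  shows "Cspan n T s \<subseteq> Cspan n T' s"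
proof
  fix \<alpha> assume "\<alpha> \<in> Cspan n T s"
  then obtain v where cyc: "(v, \<alpha>) \<in> cycles n T" and sp: "cycle_has_span n s (v, \<alpha>)"
    by (auto simp: Cspan_def)
  obtain f where f: "\<And>i. i < n \<Longrightarrow> bij_betw (f i) (verts T i) (verts T' i)"
    and e: "\<And>i v w a. i < n \<Longrightarrow> v \<in> verts T i \<Longrightarrow> w \<in> verts T (nxt n i) \<Longrightarrow>
        (v, a, w) \<in> edges T i \<longleftrightarrow> (f i v, a, f (nxt n i) w) \<in> edges T' i"
    using eq unfolding trellis_equiv_def by blast
  have n: "nxt n i < n" for i using assms(1) by (rule nxt_less)
  interpret T': vector_space scale' using lin' by (simp add: linear_trellis_def)
  have edge: "(f i (v i) - f i 0, \<alpha> i, f (nxt n i) (v (nxt n i)) - f (nxt n i) 0) \<in> edges T' i"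
    if i: "i < n" for i
  proof -
    have ve: "(v i, \<alpha> i, v (nxt n i)) \<in> edges T i" using cyc i by (simp add: cycles_def)
    then have "(f i (v i), \<alpha> i, f (nxt n i) (v (nxt n i))) \<in> edges T' i"
      using e[OF i] wf[OF i] by blast
    moreover have "(f i 0, 0, f (nxt n i) 0) \<in> edges T' i"
      using e[OF i, of 0 0 0] lin i n by (simp add: linear_trellis_def)
    then have "(scale' (-1) (f i 0), (-1) * 0, scale' (-1) (f (nxt n i) 0)) \<in> edges T' i"
      using lin' i unfolding linear_trellis_def by blast
    ultimately have "(f i (v i) + scale' (-1) (f i 0), \<alpha> i + (-1) * 0,
        f (nxt n i) (v (nxt n i)) + scale' (-1) (f (nxt n i) 0)) \<in> edges T' i"
      using lin' i unfolding linear_trellis_def by blast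
    then show ?thesis by simp
  qed
  define w where "w i = (if i < n then f i (v i) - f i 0 else 0)" for i
  have "(w, \<alpha>) \<in> cycles n T'"
    using edge cyc n by (auto simp: cycles_def w_def)
  moreover have "cycle_has_span n s (w, \<alpha>)"
    using sp by (auto simp: cycle_has_span_iff w_def)
  ultimately show "\<alpha> \<in> Cspan n T' s" by (force simp: Cspan_def)
qed

text \<open>Indices outside \<open>J\<close> are cleared together with the inactive factors, so that
  functions on the whole index type represent each vertex exactly once.\<close>

definition restr :: "nat \<Rightarrow> 'j set \<Rightarrow> ('j \<Rightarrow> span) \<Rightarrow> nat \<Rightarrow> ('j \<Rightarrow> 'a::zero) \<Rightarrow> 'j \<Rightarrow> 'a" where
  "restr n J \<sigma> i c = (\<lambda>j. if j \<in> J \<and> i \<in> active n (\<sigma> j) then c j else 0)"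

text \<open>The product of the elementary trellises \<open>x j|\<sigma> j\<close>, \<open>j \<in> J\<close>, with vertices as functions
  of \<open>j\<close>; unlike the list model it has a zero vertex and is manifestly symmetric in \<open>J\<close>.\<close>

definition coord_trellis ::
  "nat \<Rightarrow> 'j set \<Rightarrow> ('j \<Rightarrow> nat \<Rightarrow> 'a::field) \<Rightarrow> ('j \<Rightarrow> span) \<Rightarrow> ('j \<Rightarrow> 'a, 'a) trellis" where
  "coord_trellis n J x \<sigma> =
     \<lparr> verts = (\<lambda>i. range (restr n J \<sigma> i)),
       edges = (\<lambda>i. range (\<lambda>c. (restr n J \<sigma> i c, \<Sum>j\<in>J. c j * x j i, restr n J \<sigma> (nxt n i) c))) \<rparr>"

lemma restr_zero [simp]: "restr n J \<sigma> i 0 = 0"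
  by (auto simp: restr_def fun_eq_iff)

lemma restr_add: "restr n J \<sigma> i (c + d) = restr n J \<sigma> i c + restr n J \<sigma> i (d :: 'j \<Rightarrow> 'a::field)"
  by (auto simp: restr_def fun_eq_iff)

lemma restr_vscale: "restr n J \<sigma> i (vscale a c) = vscale a (restr n J \<sigma> i c)"
  by (auto simp: restr_def fun_eq_iff)

lemma restr_restr [simp]: "restr n J \<sigma> i (restr n J \<sigma> i c) = restr n J \<sigma> i c"
  by (auto simp: restr_def fun_eq_iff)

lemma verts_coord: "verts (coord_trellis n J x \<sigma>) i = range (restr n J \<sigma> i)"
  by (simp add: coord_trellis_def)

lemma verts_coord_iff: "v \<in> verts (coord_trellis n J x \<sigma>) i \<longleftrightarrow> restr n J \<sigma> i v = v"
  by (auto simp: verts_coord) (metis rangeI)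

lemma edges_coord:
  "edges (coord_trellis n J x \<sigma>) i =
     range (\<lambda>c. (restr n J \<sigma> i c, \<Sum>j\<in>J. c j * x j i, restr n J \<sigma> (nxt n i) c))"
  by (simp add: coord_trellis_def)

lemma edges_coord_subset:
  "edges (coord_trellis n J x \<sigma>) i
     \<subseteq> verts (coord_trellis n J x \<sigma>) i \<times> UNIV \<times> verts (coord_trellis n J x \<sigma>) (nxt n i)"
  by (auto simp: edges_coord verts_coord)

lemma linear_coord_trellis: "linear_trellis n vscale (coord_trellis n J x \<sigma>)"
proof -
  have 1: "(0, 0, 0) \<in> edges (coord_trellis n J x \<sigma>) i" for i
    unfolding edges_coord by (rule range_eqI[of _ _ 0]) simp
  have 2: "(v + v', a + a', w + w') \<in> edges (coord_trellis n J x \<sigma>) i"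
    if e: "(v, a, w) \<in> edges (coord_trellis n J x \<sigma>) i" "(v', a', w') \<in> edges (coord_trellis n J x \<sigma>) i"
    for v a w v' a' w' i
  proof -
    obtain c d where "(v, a, w) = (restr n J \<sigma> i c, \<Sum>j\<in>J. c j * x j i, restr n J \<sigma> (nxt n i) c)"
      "(v', a', w') = (restr n J \<sigma> i d, \<Sum>j\<in>J. d j * x j i, restr n J \<sigma> (nxt n i) d)"
      using e unfolding edges_coord by blast
    then show ?thesis unfolding edges_coord
      by (intro range_eqI[of _ _ "c + d"]) (simp add: restr_add sum.distrib algebra_simps)
  qed
  have 3: "(vscale k v, k * a, vscale k w) \<in> edges (coord_trellis n J x \<sigma>) i"
    if e: "(v, a, w) \<in> edges (coord_trellis n J x \<sigma>) i" for v a w i k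
  proof -
    obtain c where "(v, a, w) = (restr n J \<sigma> i c, \<Sum>j\<in>J. c j * x j i, restr n J \<sigma> (nxt n i) c)"
      using e unfolding edges_coord by blast
    then show ?thesis unfolding edges_coord
      by (intro range_eqI[of _ _ "vscale k c"]) (simp add: restr_vscale sum_distrib_left algebra_simps)
  qed
  have 4: "\<forall>i<n. 0 \<in> verts (coord_trellis n J x \<sigma>) i \<and>
        (\<forall>v\<in>verts (coord_trellis n J x \<sigma>) i. \<forall>w\<in>verts (coord_trellis n J x \<sigma>) i.
            v + w \<in> verts (coord_trellis n J x \<sigma>) i) \<and>
        (\<forall>c. \<forall>v\<in>verts (coord_trellis n J x \<sigma>) i. vscale c v \<in> verts (coord_trellis n J x \<sigma>) i)"
    by (simp add: verts_coord_iff restr_add restr_vscale)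
  show ?thesis
    unfolding linear_trellis_def using 1 2 3 4 vec.vector_space_axioms by blast
qed

lemma Cspan_eq_of_equiv_coord:
  fixes T :: "('v::ab_group_add, 'a::field) trellis"
  assumes "0 < n" "linear_trellis n scale T"
    and "\<And>i. i < n \<Longrightarrow> edges T i \<subseteq> verts T i \<times> UNIV \<times> verts T (nxt n i)"
    and "trellis_equiv n T (coord_trellis n J x \<sigma>)"
  shows "Cspan n T s = Cspan n (coord_trellis n J x \<sigma>) s"
  using Cspan_subset_of_equiv[OF assms(1,2) linear_coord_trellis assms(3,4)]
    Cspan_subset_of_equiv[OF assms(1) linear_coord_trellis assms(2) edges_coord_subset
      trellis_equiv_sym[OF assms(1,4)]]
  by blast

definition span_family ::
  "nat \<Rightarrow> 'j set \<Rightarrow> ('j \<Rightarrow> nat \<Rightarrow> 'a::field) \<Rightarrow> ('j \<Rightarrow> span) \<Rightarrow> bool" where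
  "span_family n J x \<sigma> \<longleftrightarrow> finite J \<and>
     (\<forall>j\<in>J. valid_span n (\<sigma> j) \<and> \<sigma> j \<noteq> Emp \<and> is_vec n (x j) \<and> vec_has_span n (\<sigma> j) (x j)) \<and>
     (\<forall>j\<in>J. \<forall>k\<in>J. \<forall>a. \<sigma> j = Sp a 0 \<longrightarrow> \<sigma> k = Sp a 0 \<longrightarrow> j = k)"

lemma combination_in_Cspan_coord:
  assumes n: "0 < n" and fam: "span_family n J x \<sigma>" and "valid_span n s"
    and le: "\<And>j. j \<in> J \<Longrightarrow> c j \<noteq> 0 \<Longrightarrow> span_le n (\<sigma> j) s"
  shows "(\<lambda>k. \<Sum>j\<in>J. c j * x j k) \<in> Cspan n (coord_trellis n J x \<sigma>) s"
proof -
  let ?v = "\<lambda>i. if i < n then restr n J \<sigma> i c else 0"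
  let ?\<alpha> = "\<lambda>k. \<Sum>j\<in>J. c j * x j k"
  have le': "active n (\<sigma> j) \<subseteq> active n s \<and> lab n (\<sigma> j) \<subseteq> lab n s" if "j \<in> J" "c j \<noteq> 0" for j
    using le[OF that] fam that n assms(3) by (simp add: span_family_def span_le_iff)
  have "(?v, ?\<alpha>) \<in> cycles n (coord_trellis n J x \<sigma>)"
    using fam nxt_less[OF n] by (auto simp: cycles_def edges_coord span_family_def is_vec_def)
  moreover have "cycle_has_span n s (?v, ?\<alpha>)"
    unfolding cycle_has_span_iff
  proof (intro allI impI conjI)
    fix i assume i: "i < n" "fst (?v, ?\<alpha>) i \<noteq> 0"
    then obtain j where "restr n J \<sigma> i c j \<noteq> 0" by (auto simp: fun_eq_iff)
    then show "i \<in> active n s" using le'[of j] by (auto simp: restr_def split: if_splits)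
  next
    fix i assume i: "i < n" "snd (?v, ?\<alpha>) i \<noteq> 0"
    then obtain j where j: "j \<in> J" "c j * x j i \<noteq> 0" by (auto elim: sum.not_neutral_contains_not_neutral)
    then have "i \<in> lab n (\<sigma> j)" using fam i by (auto simp: span_family_def vec_has_span_iff)
    then show "i \<in> lab n s" using le'[of j] j by auto
  qed
  ultimately show ?thesis by (force simp: Cspan_def)
qed

text \<open>Each edge of the cycle comes with its own coefficients. Consecutive edges share a
  vertex, which forces them to agree in the factors active there; by \<open>arc_constant\<close> the
  coefficient of a factor is then constant along its arc, and the local choices merge into one
  global \<open>c\<close>.\<close>

lemma coord_cycle_coefficients:
  assumes n: "0 < n" and fam: "span_family n J x \<sigma>"
    and cyc: "(v, \<alpha>) \<in> cycles n (coord_trellis n J x \<sigma>)"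
  obtains c where "\<alpha> = (\<lambda>k. \<Sum>j\<in>J. c j * x j k)" "\<And>i. i < n \<Longrightarrow> v i = restr n J \<sigma> i c"
proof -
  have "\<exists>d. v i = restr n J \<sigma> i d \<and> \<alpha> i = (\<Sum>j\<in>J. d j * x j i) \<and> v (nxt n i) = restr n J \<sigma> (nxt n i) d"
    if "i < n" for i
    using cyc that by (auto simp: cycles_def edges_coord)
  then obtain d where d: "\<And>i. i < n \<Longrightarrow> v i = restr n J \<sigma> i (d i)"
      "\<And>i. i < n \<Longrightarrow> \<alpha> i = (\<Sum>j\<in>J. d i j * x j i)"
      "\<And>i. i < n \<Longrightarrow> v (nxt n i) = restr n J \<sigma> (nxt n i) (d i)"
    by metis
  have "\<exists>c. \<forall>i<n. i \<in> lab n (\<sigma> j) \<longrightarrow> d i j = c" if j: "j \<in> J" for j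
  proof (rule arc_constant[OF n])
    fix i assume i: "i < n" "nxt n i \<in> active n (\<sigma> j)"
    have "restr n J \<sigma> (nxt n i) (d i) j = restr n J \<sigma> (nxt n i) (d (nxt n i)) j"
      using d(3)[OF i(1)] d(1)[OF nxt_less[OF n], of i] by simp
    then show "d i j = d (nxt n i) j" using i j by (simp add: restr_def)
  qed
  then obtain c where c: "\<And>j i. j \<in> J \<Longrightarrow> i < n \<Longrightarrow> i \<in> lab n (\<sigma> j) \<Longrightarrow> d i j = c j" by metis
  show thesis
  proof
    show "\<alpha> = (\<lambda>k. \<Sum>j\<in>J. c j * x j k)"
    proof
      fix k show "\<alpha> k = (\<Sum>j\<in>J. c j * x j k)"
      proof (cases "k < n")
        case True
        \<comment> \<open>Off the arc of factor \<open>j\<close> the local coefficient is arbitrary,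
          but there \<open>x j\<close> vanishes.\<close>
        have "d k j * x j k = c j * x j k" if "j \<in> J" for j
          using c[OF that True] fam that True by (auto simp: span_family_def vec_has_span_iff)
        then show ?thesis unfolding d(2)[OF True] by (intro sum.cong) auto
      next
        case False
        then show ?thesis using cyc fam by (simp add: cycles_def span_family_def is_vec_def)
      qed
    qed
  next
    fix i assume "i < n"
    then show "v i = restr n J \<sigma> i c"
      using d(1)[of i] c active_subset_lab[THEN subsetD] by (simp add: restr_def fun_eq_iff)
  qed
qed

text \<open>A factor with an active vertex and nonzero coefficient makes the vertices of the cycle
  nonzero along its whole half-open arc, so its span lies below \<open>s\<close>. For a factor of
  span \<open>(a, 0)\<close> the same has to be read off the label at \<open>a\<close>, where other
  factors might interfere.\<close>

lemma Cspan_coord: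
  assumes n: "0 < n" and fam: "span_family n J x \<sigma>" and s: "valid_span n s"
  shows "Cspan n (coord_trellis n J x \<sigma>) s = vec.span (x ` {j \<in> J. span_le n (\<sigma> j) s})"
proof -
  let ?K = "{j \<in> J. span_le n (\<sigma> j) s}"
  have fin: "finite J" "finite ?K" using fam by (auto simp: span_family_def)
  show ?thesis
  proof
    show "vec.span (x ` ?K) \<subseteq> Cspan n (coord_trellis n J x \<sigma>) s"
    proof
      fix y assume "y \<in> vec.span (x ` ?K)"
      then obtain c where y: "y = (\<lambda>k. \<Sum>j\<in>?K. c j * x j k)"
        unfolding vec_span_image_finite[OF fin(2)] by blast
      let ?c = "\<lambda>j. if span_le n (\<sigma> j) s then c j else 0"
      have "y = (\<lambda>k. \<Sum>j\<in>J. ?c j * x j k)"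
        unfolding y fun_eq_iff
        by (intro allI sum.mono_neutral_cong_left) (use fin in auto)
      moreover have "(\<lambda>k. \<Sum>j\<in>J. ?c j * x j k) \<in> Cspan n (coord_trellis n J x \<sigma>) s"
        by (rule combination_in_Cspan_coord[OF n fam s]) (metis (full_types))
      ultimately show "y \<in> Cspan n (coord_trellis n J x \<sigma>) s" by (simp only:)
    qed
    show "Cspan n (coord_trellis n J x \<sigma>) s \<subseteq> vec.span (x ` ?K)"
    proof
      fix \<alpha> assume "\<alpha> \<in> Cspan n (coord_trellis n J x \<sigma>) s"
      then obtain v where cyc: "(v, \<alpha>) \<in> cycles n (coord_trellis n J x \<sigma>)"
        and sp: "cycle_has_span n s (v, \<alpha>)" by (auto simp: Cspan_def)
      obtain c where \<alpha>: "\<alpha> = (\<lambda>k. \<Sum>j\<in>J. c j * x j k)"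
        and v: "\<And>i. i < n \<Longrightarrow> v i = restr n J \<sigma> i c"
        using coord_cycle_coefficients[OF n fam cyc] by blast
      have val: "valid_span n (\<sigma> j)" "\<sigma> j \<noteq> Emp" if "j \<in> J" for j
        using fam that by (auto simp: span_family_def)
      have act: "span_le n (\<sigma> j) s" if j: "j \<in> J" "c j \<noteq> 0" "active n (\<sigma> j) \<noteq> {}" for j
      proof (rule span_le_of_active[OF n val(1)[OF j(1)] s j(3)])
        fix i assume i: "i < n" "i \<in> active n (\<sigma> j)"
        then have "v i \<noteq> 0" using v[OF i(1)] j by (auto simp: restr_def fun_eq_iff)
        then show "i \<in> active n s" using sp i by (simp add: cycle_has_span_iff)
      qed
      \<comment> \<open>The condition is on the term rather than on \<open>c j\<close>: a factor
        with zero vector and span \<open>(a, 0)\<close> may have any coefficient without being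
        noticed.\<close>
      have le: "span_le n (\<sigma> j) s" if j: "j \<in> J" and nz: "vscale (c j) (x j) \<noteq> 0" for j
      proof (cases "active n (\<sigma> j) = {}")
        case False
        have "c j \<noteq> 0" using nz by (auto simp: fun_eq_iff)
        then show ?thesis using act j False by blast
      next
        case True
        then obtain a where a: "\<sigma> j = Sp a 0" using active_empty_imp val[OF j] by blast
        have an: "a < n" using val[OF j] a by simp
        then have lab: "lab n (\<sigma> j) = {a}" using a by (auto simp: icc_def)
        obtain k where k: "c j * x j k \<noteq> 0" using nz by (auto simp: fun_eq_iff)
        then have "k < n" using fam j by (auto simp: span_family_def is_vec_def not_le[symmetric])
        with k have "k \<in> lab n (\<sigma> j)" using fam j by (auto simp: span_family_def vec_has_span_iff)
        with k lab have nz': "c j * x j a \<noteq> 0" by simp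
        have "a \<in> lab n s"
        proof (rule ccontr)
          assume na: "a \<notin> lab n s"
          \<comment> \<open>Nothing can cancel the contribution of factor \<open>j\<close> at
            \<open>a\<close>: a contributing factor with active vertices would lie below
            \<open>s\<close> and put \<open>a\<close> into \<open>lab n s\<close>, and a second
            factor of span \<open>(a, 0)\<close> does not exist.\<close>
          have "c k * x k a = 0" if kJ: "k \<in> J - {j}" for k
          proof (rule ccontr)
            assume nz: "c k * x k a \<noteq> 0"
            then have ak: "a \<in> lab n (\<sigma> k)"
              using fam kJ an by (auto simp: span_family_def vec_has_span_iff)
            show False
            proof (cases "active n (\<sigma> k) = {}")
              case False
              then have "span_le n (\<sigma> k) s" using act[of k] kJ nz by auto
              then show False using ak na kJ n s val by (auto simp: span_le_iff)
            next
              case True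
              then obtain b where b: "\<sigma> k = Sp b 0" using active_empty_imp val kJ by blast
              then have "b = a" using ak val[of k] kJ by (auto simp: icc_def)
              then show False using a b fam j kJ unfolding span_family_def by blast
            qed
          qed
          then have "\<alpha> a = c j * x j a"
            unfolding \<alpha> using fin j by (subst sum.remove[of J j]) (auto intro!: sum.neutral, blast)
          then show False using nz' sp na an by (auto simp: cycle_has_span_iff)
        qed
        then show ?thesis using n s val[OF j] True lab by (simp add: span_le_iff)
      qed
      have "\<alpha> = (\<Sum>j\<in>J. vscale (c j) (x j))"
        by (simp add: \<alpha> fun_eq_iff sum_fun_apply)
      also have "\<dots> = (\<Sum>j\<in>?K. vscale (c j) (x j))"
        using fin le by (intro sum.mono_neutral_right) auto
      also have "\<dots> \<in> vec.span (x ` ?K)"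
        by (auto intro!: vec.span_sum intro: vec.span_scale vec.span_base)
      finally show "\<alpha> \<in> vec.span (x ` ?K)" .
    qed
  qed
qed

section \<open>Comparison of the coordinate model with products of lists\<close>

lemma verts_elem_prod:
  "distinct js \<Longrightarrow> verts (elem_prod n (map (\<lambda>j. (x j, \<sigma> j)) js)) i =
     range (\<lambda>c. map (\<lambda>j. if i \<in> active n (\<sigma> j) then c j else 0) js)"
proof (induction js)
  case (Cons j js)
  show ?case (is "?L = ?R")
  proof
    show "?L \<subseteq> ?R"
    proof
      fix w assume "w \<in> ?L"
      then obtain v vs where w: "w = v # vs" "v \<in> (if i \<in> active n (\<sigma> j) then UNIV else {0})"
        "vs \<in> range (\<lambda>c. map (\<lambda>j. if i \<in> active n (\<sigma> j) then c j else 0) js)"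
        using Cons by (auto simp: elem_trellis_def Let_def)
      then obtain c where c: "vs = map (\<lambda>j. if i \<in> active n (\<sigma> j) then c j else 0) js" by blast
      have "w = map (\<lambda>k. if i \<in> active n (\<sigma> k) then (c(j := v)) k else 0) (j # js)"
        using w c Cons.prems by (auto split: if_splits)
      then show "w \<in> ?R" by blast
    qed
    show "?R \<subseteq> ?L" using Cons by (auto simp: elem_trellis_def Let_def)
  qed
qed simp

lemma edges_elem_prod_Cons:
  "edges (elem_prod n ((x, s) # fs)) i =
     {((if i \<in> active n s then b else 0) # vs, b * x i + a,
       (if nxt n i \<in> active n s then b else 0) # ws) | b vs a ws.
        (vs, a, ws) \<in> edges (elem_prod n fs) i}"
proof -
  have el: "edges (elem_trellis n x s) i =
      {(if i \<in> active n s then b else 0, b * x i, if nxt n i \<in> active n s then b else 0) | b. True}"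
    by (simp add: elem_trellis_def Let_def if_distrib cong: if_cong)
  show ?thesis
    by (simp only: elem_prod.simps Let_def trellis.select_convs el mem_Collect_eq) blast
qed

lemma edges_elem_prod:
  "distinct js \<Longrightarrow> edges (elem_prod n (map (\<lambda>j. (x j, \<sigma> j)) js)) i =
     range (\<lambda>c. (map (\<lambda>j. if i \<in> active n (\<sigma> j) then c j else 0) js,
                 \<Sum>j\<in>set js. c j * x j i,
                 map (\<lambda>j. if nxt n i \<in> active n (\<sigma> j) then c j else 0) js))"
proof (induction js)
  case (Cons j js)
  define p where "p c = map (\<lambda>j. if i \<in> active n (\<sigma> j) then c j else 0) js" for c :: "'a \<Rightarrow> 'b"
  define q where "q c = (\<Sum>j\<in>set js. c j * x j i)" for c :: "'a \<Rightarrow> 'b"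
  define r where "r c = map (\<lambda>j. if nxt n i \<in> active n (\<sigma> j) then c j else 0) js" for c :: "'a \<Rightarrow> 'b"
  define P where "P b = (if i \<in> active n (\<sigma> j) then b else 0)" for b :: 'b
  define R where "R b = (if nxt n i \<in> active n (\<sigma> j) then b else 0)" for b :: 'b
  have IH: "edges (elem_prod n (map (\<lambda>j. (x j, \<sigma> j)) js)) i = range (\<lambda>c. (p c, q c, r c))"
    using Cons by (simp add: p_def q_def r_def)
  \<comment> \<open>By distinctness the coefficient of the head can be prescribed without disturbing
    the tail.\<close>
  have upd: "p (c(j := b)) = p c" "q (c(j := b)) = q c" "r (c(j := b)) = r c" for b c
    using Cons.prems by (auto simp: p_def q_def r_def intro!: sum.cong)
  have "edges (elem_prod n (map (\<lambda>j. (x j, \<sigma> j)) (j # js))) i =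
      {(P b # vs, b * x j i + a, R b # ws) | b vs a ws. (vs, a, ws) \<in> range (\<lambda>c. (p c, q c, r c))}"
    by (simp only: list.map edges_elem_prod_Cons IH P_def R_def)
  also have "\<dots> = range (\<lambda>c. (P (c j) # p c, c j * x j i + q c, R (c j) # r c))"
  proof (intro equalityI subsetI)
    fix e assume "e \<in> {(P b # vs, b * x j i + a, R b # ws) | b vs a ws.
      (vs, a, ws) \<in> range (\<lambda>c. (p c, q c, r c))}"
    then obtain b c where "e = (P b # p c, b * x j i + q c, R b # r c)" by blast
    then show "e \<in> range (\<lambda>c. (P (c j) # p c, c j * x j i + q c, R (c j) # r c))"
      by (intro range_eqI[of _ _ "c(j := b)"]) (simp add: upd)
  qed blast
  finally show ?case
    using Cons.prems by (simp add: p_def q_def r_def P_def R_def)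
qed simp

lemma coord_equiv_elem_prod:
  assumes "distinct js"
  shows "trellis_equiv n (coord_trellis n (set js) x \<sigma>) (elem_prod n (map (\<lambda>j. (x j, \<sigma> j)) js))"
proof -
  let ?J = "set js"
  have map_restr: "map (restr n ?J \<sigma> i c) js = map (\<lambda>j. if i \<in> active n (\<sigma> j) then c j else 0) js"
    for i and c :: "'a \<Rightarrow> 'b"
    by (simp add: restr_def)
  have inj: "v = w" if "map v js = map w js" "restr n ?J \<sigma> i v = v" "restr n ?J \<sigma> i w = w"
    for i and v w :: "'a \<Rightarrow> 'b"
  proof
    fix j show "v j = w j"
    proof (cases "j \<in> ?J")
      case False
      have "v j = restr n ?J \<sigma> i v j" "w j = restr n ?J \<sigma> i w j" using that by simp_all
      with False show ?thesis by (simp add: restr_def)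
    qed (use that(1) in simp)
  qed
  have "bij_betw (\<lambda>v. map v js) (verts (coord_trellis n ?J x \<sigma>) i)
      (verts (elem_prod n (map (\<lambda>j. (x j, \<sigma> j)) js)) i)" for i
  proof (rule bij_betw_imageI)
    show "inj_on (\<lambda>v. map v js) (verts (coord_trellis n ?J x \<sigma>) i)"
      by (intro inj_onI) (metis inj verts_coord_iff)
    show "(\<lambda>v. map v js) ` verts (coord_trellis n ?J x \<sigma>) i
        = verts (elem_prod n (map (\<lambda>j. (x j, \<sigma> j)) js)) i"
      by (simp add: verts_coord verts_elem_prod[OF assms] image_image map_restr)
  qed
  moreover have "(v, a, w) \<in> edges (coord_trellis n ?J x \<sigma>) i \<longleftrightarrow>
      (map v js, a, map w js) \<in> edges (elem_prod n (map (\<lambda>j. (x j, \<sigma> j)) js)) i"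
    if vw: "v \<in> verts (coord_trellis n ?J x \<sigma>) i" "w \<in> verts (coord_trellis n ?J x \<sigma>) (nxt n i)"
    for i v a w
  proof
    assume "(v, a, w) \<in> edges (coord_trellis n ?J x \<sigma>) i"
    then show "(map v js, a, map w js) \<in> edges (elem_prod n (map (\<lambda>j. (x j, \<sigma> j)) js)) i"
      by (auto simp: edges_coord edges_elem_prod[OF assms] map_restr)
  next
    assume "(map v js, a, map w js) \<in> edges (elem_prod n (map (\<lambda>j. (x j, \<sigma> j)) js)) i"
    then obtain c where c: "map v js = map (restr n ?J \<sigma> i c) js" "a = (\<Sum>j\<in>?J. c j * x j i)"
      "map w js = map (restr n ?J \<sigma> (nxt n i) c) js"
      unfolding edges_elem_prod[OF assms] map_restr by blast
    have "v = restr n ?J \<sigma> i c" "w = restr n ?J \<sigma> (nxt n i) c"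
      using inj[OF c(1)] inj[OF c(3)] vw by (simp_all add: verts_coord_iff)
    then show "(v, a, w) \<in> edges (coord_trellis n ?J x \<sigma>) i"
      using c(2) by (auto simp: edges_coord)
  qed
  ultimately show ?thesis unfolding trellis_equiv_def
    by (intro exI[of _ "\<lambda>i v. map v js"]) blast
qed

section \<open>Exchange of generators\<close>

text \<open>A change of coefficients descends to the vertices at \<open>i\<close> if the coordinates
  active after it depend only on those active before it. The first two assumptions say this for
  \<open>g\<close> and its inverse \<open>h\<close>; \<open>label\<close> takes care of the
  edges.\<close>

lemma coord_equiv_of_linear_iso:
  fixes x :: "'j \<Rightarrow> nat \<Rightarrow> 'a::field" and x' :: "'k \<Rightarrow> nat \<Rightarrow> 'a"
  assumes g: "\<And>i c. restr n J' \<sigma>' i (g (restr n J \<sigma> i c)) = restr n J' \<sigma>' i (g c)"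
    and h: "\<And>i c. restr n J \<sigma> i (h (restr n J' \<sigma>' i c)) = restr n J \<sigma> i (h c)"
    and hg: "\<And>c j. j \<in> J \<Longrightarrow> h (g c) j = c j"
    and gh: "\<And>c j. j \<in> J' \<Longrightarrow> g (h c) j = c j"
    and label: "\<And>i c. i < n \<Longrightarrow> (\<Sum>j\<in>J'. g c j * x' j i) = (\<Sum>j\<in>J. c j * x j i)"
  shows "trellis_equiv n (coord_trellis n J x \<sigma>) (coord_trellis n J' x' \<sigma>')"
proof -
  define f where "f i v = restr n J' \<sigma>' i (g v)" for i v
  define f' where "f' i v = restr n J \<sigma> i (h v)" for i v
  have restr_hg: "restr n J \<sigma> i (h (g c)) = restr n J \<sigma> i c" for i c
    by (auto simp: restr_def hg)
  have restr_gh: "restr n J' \<sigma>' i (g (h c)) = restr n J' \<sigma>' i c" for i c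
    by (auto simp: restr_def gh)
  have f'f: "f' i (f i v) = v" if "restr n J \<sigma> i v = v" for i v
    using that by (simp add: f_def f'_def h restr_hg)
  have ff': "f i (f' i v) = v" if "restr n J' \<sigma>' i v = v" for i v
    using that by (simp add: f_def f'_def g restr_gh)
  have "bij_betw (f i) (verts (coord_trellis n J x \<sigma>) i) (verts (coord_trellis n J' x' \<sigma>') i)" for i
    by (rule bij_betw_byWitness[where f' = "f' i"])
      (auto simp: verts_coord_iff f'f ff', auto simp: f_def f'_def)
  moreover have "(v, a, w) \<in> edges (coord_trellis n J x \<sigma>) i \<longleftrightarrow>
      (f i v, a, f (nxt n i) w) \<in> edges (coord_trellis n J' x' \<sigma>') i"
    if i: "i < n" and vw: "v \<in> verts (coord_trellis n J x \<sigma>) i"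
      "w \<in> verts (coord_trellis n J x \<sigma>) (nxt n i)" for i v a w
  proof
    assume "(v, a, w) \<in> edges (coord_trellis n J x \<sigma>) i"
    then obtain c where c: "v = restr n J \<sigma> i c" "a = (\<Sum>j\<in>J. c j * x j i)"
      "w = restr n J \<sigma> (nxt n i) c" by (auto simp: edges_coord)
    then show "(f i v, a, f (nxt n i) w) \<in> edges (coord_trellis n J' x' \<sigma>') i"
      unfolding edges_coord f_def by (intro range_eqI[of _ _ "g c"]) (simp add: g label[OF i])
  next
    assume "(f i v, a, f (nxt n i) w) \<in> edges (coord_trellis n J' x' \<sigma>') i"
    then obtain d where d: "f i v = restr n J' \<sigma>' i d" "a = (\<Sum>j\<in>J'. d j * x' j i)"
      "f (nxt n i) w = restr n J' \<sigma>' (nxt n i) d" by (auto simp: edges_coord)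
    have "v = f' i (f i v)" "w = f' (nxt n i) (f (nxt n i) w)"
      using vw f'f by (simp_all add: verts_coord_iff)
    then have "v = restr n J \<sigma> i (h d)" "w = restr n J \<sigma> (nxt n i) (h d)"
      by (simp_all add: d f'_def h)
    moreover have "a = (\<Sum>j\<in>J. h d j * x j i)"
      using label[OF i, of "h d"] by (simp add: d gh)
    ultimately show "(v, a, w) \<in> edges (coord_trellis n J x \<sigma>) i"
      by (auto simp: edges_coord)
  qed
  ultimately show ?thesis unfolding trellis_equiv_def by blast
qed

text \<open>Expanding the new vector distributes its coefficient \<open>c k\<close> over all
  \<open>j\<close> with \<open>a j \<noteq> 0\<close>, which is the map \<open>?g\<close>. Wherever
  such a \<open>j\<close> is active, \<open>k\<close> is active too, so \<open>c k\<close> can be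
  read off the vertex and the map descends. Dividing by \<open>a k\<close> inverts it.\<close>

lemma coord_equiv_replace:
  fixes x :: "'j \<Rightarrow> nat \<Rightarrow> 'a::field"
  assumes "finite J" "k \<in> J" "a k \<noteq> 0"
    and act: "\<And>j. j \<in> J \<Longrightarrow> a j \<noteq> 0 \<Longrightarrow> active n (\<sigma> j) \<subseteq> active n (\<sigma> k)"
  shows "trellis_equiv n (coord_trellis n J (x(k := (\<lambda>t. \<Sum>j\<in>J. a j * x j t))) \<sigma>)
           (coord_trellis n J x \<sigma>)"
proof (rule coord_equiv_of_linear_iso)
  let ?g = "\<lambda>c j. if j = k then a k * c k else c j + a j * c k"
  let ?h = "\<lambda>c j. if j = k then c k / a k else c j - a j * (c k / a k)"
  show "restr n J \<sigma> i (?g (restr n J \<sigma> i c)) = restr n J \<sigma> i (?g c)" for i c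
    using act assms(2) by (auto simp: restr_def fun_eq_iff)
  show "restr n J \<sigma> i (?h (restr n J \<sigma> i c)) = restr n J \<sigma> i (?h c)" for i c
    using act assms(2) by (auto simp: restr_def fun_eq_iff)
  show "?h (?g c) j = c j" for c j using assms(3) by simp
  show "?g (?h c) j = c j" for c j using assms(3) by simp
  show "(\<Sum>j\<in>J. ?g c j * x j i) = (\<Sum>j\<in>J. c j * (x(k := (\<lambda>t. \<Sum>j\<in>J. a j * x j t))) j i)" for i c
  proof -
    have "(\<Sum>j\<in>J. ?g c j * x j i) = a k * c k * x k i + (\<Sum>j\<in>J - {k}. (c j + a j * c k) * x j i)"
      using assms(1,2) by (simp add: sum.remove[of J k])
    also have "\<dots> = c k * (\<Sum>j\<in>J. a j * x j i) + (\<Sum>j\<in>J - {k}. c j * x j i)"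
      using assms(1,2) by (simp add: sum.remove[of J k] algebra_simps sum.distrib sum_distrib_left)
    also have "\<dots> = (\<Sum>j\<in>J. c j * (x(k := (\<lambda>t. \<Sum>j\<in>J. a j * x j t))) j i)"
      using assms(1,2) by (subst (3) sum.remove[of J k]) auto
    finally show ?thesis .
  qed
qed

text \<open>Moves a vector to the index at which the other family has it. A transposition is its own
  inverse and serves as both \<open>g\<close> and \<open>h\<close>, so the corresponding goals come
  in equal pairs.\<close>

lemma coord_equiv_transpose:
  fixes x :: "'j \<Rightarrow> nat \<Rightarrow> 'a::field"
  assumes "j \<in> J" "k \<in> J" "\<sigma> j = \<sigma> k"
  shows "trellis_equiv n (coord_trellis n J (x \<circ> transpose j k) \<sigma>) (coord_trellis n J x \<sigma>)"
proof (rule coord_equiv_of_linear_iso)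
  let ?g = "\<lambda>c :: 'j \<Rightarrow> 'a. c \<circ> transpose j k"
  have mem: "transpose j k i \<in> J \<longleftrightarrow> i \<in> J" "\<sigma> (transpose j k i) = \<sigma> i" for i
    using assms by (auto simp: transpose_def)
  show "restr n J \<sigma> i (?g (restr n J \<sigma> i c)) = restr n J \<sigma> i (?g c)" for i c
    by (auto simp: restr_def fun_eq_iff mem)
  then show "restr n J \<sigma> i (?g (restr n J \<sigma> i c)) = restr n J \<sigma> i (?g c)" for i c .
  show "?g (?g c) i = c i" for c i by simp
  then show "?g (?g c) i = c i" for c i .
  have bij: "bij_betw (transpose j k) J J"
    by (rule bij_betw_byWitness[where f' = "transpose j k"]) (auto simp: mem)
  show "(\<Sum>l\<in>J. ?g c l * x l i) = (\<Sum>l\<in>J. c l * (x \<circ> transpose j k) l i)" for i c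
    using sum.reindex_bij_betw[OF bij, of "\<lambda>l. ?g c l * x l i"] by (simp add: o_def)
qed

text \<open>A count modulo the span of \<open>G\<close>. Without a redundant vector, the family
  \<open>x\<close> on \<open>P\<close> would be independent modulo \<open>G\<close>, giving
  dimension \<open>card P\<close>; but \<open>x' j\<close> vanishes modulo \<open>G\<close>, so
  \<open>card P - 1\<close> vectors generate the same quotient.\<close>

lemma (in vector_space) exists_redundant_generator:
  assumes "finite P" "finite G" and span: "span (x ` P \<union> G) = span (x' ` P \<union> G)"
    and j: "j \<in> P" "x' j \<in> span G"
  shows "\<exists>k\<in>P. x k \<in> span (x ` (P - {k}) \<union> G)"
proof (rule ccontr)
  assume "\<not> ?thesis"
  then have nin: "x k \<notin> span (x ` (P - {k}) \<union> G)" if "k \<in> P" for k using that by blast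
  obtain B where B: "B \<subseteq> G" "independent B" "G \<subseteq> span B"
    using maximal_independent_subset[of G] by blast
  have finB: "finite B" using B assms finite_subset by blast
  \<comment> \<open>The cardinality is carried along because it records that \<open>x\<close> is
    injective on \<open>Q\<close> and avoids \<open>B\<close>.\<close>
  have "Q \<subseteq> P \<Longrightarrow> independent (x ` Q \<union> B) \<and> card (x ` Q \<union> B) = card Q + card B" if "finite Q" for Q
    using that
  proof (induction Q rule: finite_induct)
    case (insert k Q)
    have "x ` Q \<union> B \<subseteq> x ` (P - {k}) \<union> G" using insert B by auto
    then have "x k \<notin> span (x ` Q \<union> B)" using nin[of k] span_mono insert.prems by blast
    moreover from this have "x k \<notin> x ` Q \<union> B" by (rule contrapos_nn) (rule span_base)
    ultimately show ?case using insert finB by (simp add: independent_insertI)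
  qed (use B in simp)
  from this[OF assms(1)] have ind: "independent (x ` P \<union> B)" "card (x ` P \<union> B) = card P + card B"
    by auto
  let ?S = "x' ` (P - {j}) \<union> B"
  have GS: "G \<subseteq> span ?S" using B(3) span_mono[of B ?S] by blast
  then have "span G \<subseteq> span ?S" by (simp add: span_minimal)
  with j have "x' ` P \<subseteq> span ?S" by (auto intro: span_base)
  with GS have "span (x' ` P \<union> G) \<subseteq> span ?S" by (simp add: span_minimal)
  moreover have "x ` P \<union> B \<subseteq> span (x ` P \<union> G)"
    using B(1) span_superset[of "x ` P \<union> G"] by auto
  ultimately have "x ` P \<union> B \<subseteq> span ?S" unfolding span by (rule subset_trans[rotated])
  then have "card (x ` P \<union> B) \<le> card ?S"
    using independent_span_bound[of ?S "x ` P \<union> B"] ind assms finB by auto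
  also have "\<dots> \<le> card (P - {j}) + card B"
    using card_Un_le[of "x' ` (P - {j})" B] card_image_le[OF finite_Diff[OF assms(1)], of x' "{j}"] by linarith
  also have "\<dots> < card P + card B" using j assms(1) using card_Diff1_less[of P j] by simp
  finally show False using ind by simp
qed

text \<open>Take any expansion of \<open>x' j\<close>. If it involves no index of \<open>P\<close>,
  then \<open>x' j\<close> is redundant modulo the indices outside \<open>P\<close>, and the count
  yields a relation expressing some \<open>x k\<close>, \<open>k \<in> P\<close>, through the other
  vectors. Adding this relation changes the expansion but not its value.\<close>

lemma exists_exchange:
  fixes x x' :: "'j \<Rightarrow> nat \<Rightarrow> 'a::field"
  assumes "finite D" "P \<subseteq> D" "j \<in> P"
    and span: "vec.span (x ` D) = vec.span (x' ` P \<union> x ` (D - P))"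
  obtains k a where "k \<in> P" "a k \<noteq> 0" "x' j = (\<lambda>t. \<Sum>i\<in>D. a i * x i t)"
proof -
  have finP: "finite P" using assms finite_subset by blast
  have "x' j \<in> vec.span (x ` D)" unfolding span using assms by (auto intro: vec.span_base)
  then obtain a where a: "x' j = (\<lambda>t. \<Sum>i\<in>D. a i * x i t)"
    using vec_span_image_finite[OF assms(1), of x] by auto
  show thesis
  proof (cases "\<exists>k\<in>P. a k \<noteq> 0")
    case True
    then show ?thesis using a that by blast
  next
    case False
    have "x' j = (\<lambda>t. \<Sum>i\<in>D - P. a i * x i t)"
      unfolding a fun_eq_iff using assms False by (intro allI sum.mono_neutral_right) auto
    then have "x' j \<in> vec.span (x ` (D - P))"
      using vec_span_image_finite[of "D - P" x] assms(1) by auto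
    moreover have "x ` D = x ` P \<union> x ` (D - P)" using assms by auto
    ultimately obtain k where k: "k \<in> P" "x k \<in> vec.span (x ` (P - {k}) \<union> x ` (D - P))"
      using vec.exists_redundant_generator[of P "x ` (D - P)" x x' j] span assms finP by auto
    moreover have "x ` (P - {k}) \<union> x ` (D - P) = x ` (D - {k})" using assms k by auto
    ultimately have "x k \<in> vec.span (x ` (D - {k}))" by simp
    then obtain b where b: "x k = (\<lambda>t. \<Sum>i\<in>D - {k}. b i * x i t)"
      using vec_span_image_finite[of "D - {k}" x] assms(1) by auto
    have kD: "k \<in> D" using k assms by auto
    \<comment> \<open>The coefficients \<open>a\<close> plus those of the relation
      \<open>x k - (\<Sum>i\<in>D - {k}. b i * x i) = 0\<close>. Since \<open>a k = 0\<close>, the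
      coefficient at \<open>k\<close> becomes 1.\<close>
    define e where "e i = (if i = k then 1 else a i - b i)" for i
    have "x' j t = (\<Sum>i\<in>D. e i * x i t)" for t
    proof -
      have "(\<Sum>i\<in>D. e i * x i t) = x k t + (\<Sum>i\<in>D - {k}. (a i - b i) * x i t)"
        using kD assms(1) by (simp add: sum.remove[of D k] e_def)
      also have "\<dots> = x k t + (\<Sum>i\<in>D - {k}. a i * x i t) - (\<Sum>i\<in>D - {k}. b i * x i t)"
        by (simp add: algebra_simps sum_subtractf)
      also have "(\<Sum>i\<in>D - {k}. b i * x i t) = x k t" using fun_cong[OF b, of t] by simp
      also have "(\<Sum>i\<in>D - {k}. a i * x i t) = (\<Sum>i\<in>D. a i * x i t)"
        using kD assms(1) False k by (simp add: sum.remove[of D k])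
      finally show ?thesis using fun_cong[OF a, of t] by simp
    qed
    then show ?thesis using that[of k e] k by (auto simp: e_def)
  qed
qed

text \<open>The right-hand side of the theorem, with \<open>C\<close> in the role of \<open>s \<mapsto> C\<^sub>s(T)\<close>.\<close>

definition generates :: "nat \<Rightarrow> 'j set \<Rightarrow> ('j \<Rightarrow> nat \<Rightarrow> 'a::field) \<Rightarrow> ('j \<Rightarrow> span) \<Rightarrow>
    (span \<Rightarrow> (nat \<Rightarrow> 'a) set) \<Rightarrow> span \<Rightarrow> bool" where
  "generates n J x \<sigma> C s \<longleftrightarrow>
     C s = vec.span (x ` {j \<in> J. \<sigma> j = s} \<union> (\<Union>s'\<in>{s'. valid_span n s' \<and> span_less n s' s}. C s'))"

text \<open>Each \<open>C s'\<close> below \<open>s\<close> is generated by vectors of span at most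
  \<open>s'\<close>, and each \<open>x j\<close> lies in \<open>C\<close> of its own span. The set
  \<open>A\<close> is kept free so that the vectors of span exactly \<open>s\<close> can come from
  either of the two families.\<close>

lemma span_less_subspaces:
  assumes n: "0 < n" and val: "\<And>j. j \<in> J \<Longrightarrow> valid_span n (\<sigma> j)" and s: "valid_span n s"
    and C: "\<And>s. valid_span n s \<Longrightarrow> C s = vec.span (x ` {j \<in> J. span_le n (\<sigma> j) s})"
  shows "vec.span (A \<union> (\<Union>s'\<in>{s'. valid_span n s' \<and> span_less n s' s}. C s')) =
         vec.span (A \<union> x ` {j \<in> J. span_less n (\<sigma> j) s})"
proof
  let ?L = "{j \<in> J. span_less n (\<sigma> j) s}"
  let ?U = "\<Union>s'\<in>{s'. valid_span n s' \<and> span_less n s' s}. C s'"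
  have "C s' \<subseteq> vec.span (A \<union> x ` ?L)" if s': "valid_span n s'" "span_less n s' s" for s'
  proof -
    have "span_less n (\<sigma> j) s" if "j \<in> J" "span_le n (\<sigma> j) s'" for j
    proof -
      have v: "valid_span n (\<sigma> j)" using val that by blast
      have le: "span_le n (\<sigma> j) s" using span_le_trans[OF n v s'(1) s that(2)] s' by (simp add: span_less_def)
      show ?thesis
      proof (cases "\<sigma> j = s'")
        case False
        then show ?thesis using span_less_le_trans[OF n v s'(1) s] that s' by (auto simp: span_less_def)
      qed (use s' in simp)
    qed
    then show ?thesis unfolding C[OF s'(1)] by (intro vec.span_mono) auto
  qed
  then show "vec.span (A \<union> ?U) \<subseteq> vec.span (A \<union> x ` ?L)"
    by (intro vec.span_minimal) (auto intro: vec.span_base)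
  have "x j \<in> ?U" if "j \<in> ?L" for j
  proof -
    have "valid_span n (\<sigma> j)" using val that by auto
    moreover have "x j \<in> C (\<sigma> j)"
      unfolding C[OF \<open>valid_span n (\<sigma> j)\<close>] using that span_le_refl[OF n \<open>valid_span n (\<sigma> j)\<close>]
      by (auto intro!: vec.span_base)
    ultimately show ?thesis using that by auto
  qed
  then show "vec.span (A \<union> x ` ?L) \<subseteq> vec.span (A \<union> ?U)"
    by (intro vec.span_mono) auto
qed

lemma span_le_split:
  assumes "0 < n" "valid_span n s"
  shows "{j \<in> J. span_le n (\<sigma> j) s} = {j \<in> J. \<sigma> j = s} \<union> {j \<in> J. span_less n (\<sigma> j) s}"
  using span_le_refl[OF assms] by (auto simp: span_less_def)

lemma generates_own_family:
  assumes n: "0 < n" and val: "\<And>j. j \<in> J \<Longrightarrow> valid_span n (\<sigma> j)" and s: "valid_span n s"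
    and C: "\<And>s. valid_span n s \<Longrightarrow> C s = vec.span (x ` {j \<in> J. span_le n (\<sigma> j) s})"
  shows "generates n J x \<sigma> C s"
  unfolding generates_def
  by (subst span_less_subspaces[where x = x and J = J and \<sigma> = \<sigma>, OF n val s C])
    (simp_all add: C[OF s] span_le_split[OF n s] image_Un)

text \<open>Each round makes one more index agree, in whatever order the spans come up. The
  hypothesis \<open>gen\<close> refers to the old family only through \<open>C\<close>, and
  \<open>C\<close> does not change under equivalence, so it survives every exchange.\<close>

lemma coord_equiv_of_generates:
  fixes x x' :: "'j \<Rightarrow> nat \<Rightarrow> 'a::field"
  assumes n: "0 < n" and "span_family n J x \<sigma>" and fam': "span_family n J x' \<sigma>"
    and "\<And>s. valid_span n s \<Longrightarrow> C s = vec.span (x ` {j \<in> J. span_le n (\<sigma> j) s})"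
    and gen: "\<And>j. j \<in> J \<Longrightarrow> generates n J x' \<sigma> C (\<sigma> j)"
  shows "trellis_equiv n (coord_trellis n J x \<sigma>) (coord_trellis n J x' \<sigma>)"
  using assms(2,4)
proof (induction "card {j \<in> J. x j \<noteq> x' j}" arbitrary: x rule: less_induct)
  case (less x)
  note fam = less.prems(1) and C = less.prems(2)
  have fin: "finite J" and val: "\<And>j. j \<in> J \<Longrightarrow> valid_span n (\<sigma> j)"
    using fam by (auto simp: span_family_def)
  show ?case
  proof (cases "\<exists>j\<in>J. x j \<noteq> x' j")
    case False
    then show ?thesis
      by (intro coord_equiv_of_linear_iso[where g = "\<lambda>c. c" and h = "\<lambda>c. c"]) auto
  next
    case True
    then obtain j where j: "j \<in> J" "x j \<noteq> x' j" by blast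
    define s where "s = \<sigma> j"
    have s: "valid_span n s" using val j by (simp add: s_def)
    define D where "D = {j \<in> J. span_le n (\<sigma> j) s}"
    \<comment> \<open>Only unmatched vectors of the same span are candidates for removal, so that no
      earlier match is undone.\<close>
    define P where "P = {j \<in> J. \<sigma> j = s \<and> x j \<noteq> x' j}"
    have DJ: "finite D" "D \<subseteq> J" and PD: "P \<subseteq> D" "j \<in> P"
      using fin j s span_le_refl[OF n s] by (auto simp: D_def P_def s_def)
    have "x' ` {j \<in> J. \<sigma> j = s} \<union> x ` {j \<in> J. span_less n (\<sigma> j) s} = x' ` P \<union> x ` (D - P)"
    proof -
      have "x' ` {j \<in> J. \<sigma> j = s} = x' ` P \<union> x ` {j \<in> J. \<sigma> j = s \<and> x j = x' j}"
        by (force simp: P_def)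
      moreover have "D - P = {j \<in> J. \<sigma> j = s \<and> x j = x' j} \<union> {j \<in> J. span_less n (\<sigma> j) s}"
        unfolding D_def span_le_split[OF n s] by (auto simp: P_def span_less_def)
      ultimately show ?thesis by (simp add: image_Un Un_assoc)
    qed
    then have "vec.span (x ` D) = vec.span (x' ` P \<union> x ` (D - P))"
      using gen[OF j(1)] C[OF s] span_less_subspaces[OF n val s C, of "x' ` {j \<in> J. \<sigma> j = s}"]
      by (simp add: generates_def D_def s_def)
    then obtain k a where k: "k \<in> P" "a k \<noteq> 0" and a: "x' j = (\<lambda>t. \<Sum>i\<in>D. a i * x i t)"
      using exists_exchange[OF DJ(1) PD] by metis
    define b where "b i = (if i \<in> D then a i else 0)" for i
    have b: "x' j = (\<lambda>t. \<Sum>i\<in>J. b i * x i t)"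
      unfolding a fun_eq_iff b_def using DJ fin by (intro allI sum.mono_neutral_cong_left) auto
    have kJ: "k \<in> J" "\<sigma> k = s" "k \<in> D" using k PD by (auto simp: P_def)
    \<comment> \<open>First \<open>x' j\<close> takes the place of \<open>x k\<close>; the
      transposition then brings it to index \<open>j\<close> and puts the displaced
      \<open>x j\<close> at \<open>k\<close>. As \<open>k\<close> was unmatched before, the set of
      disagreements loses \<open>j\<close> and gains nothing.\<close>
    define y where "y = x(k := x' j)"
    define z where "z = y \<circ> transpose j k"
    have yx: "trellis_equiv n (coord_trellis n J y \<sigma>) (coord_trellis n J x \<sigma>)"
      unfolding y_def b
    proof (rule coord_equiv_replace[OF fin kJ(1)])
      show "b k \<noteq> 0" using k kJ by (simp add: b_def)
      fix i assume "i \<in> J" "b i \<noteq> 0"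
      then have "i \<in> J" "span_le n (\<sigma> i) s" by (auto simp: b_def D_def split: if_splits)
      then show "active n (\<sigma> i) \<subseteq> active n (\<sigma> k)"
        using span_le_iff[OF n val[of i] s] kJ by simp
    qed
    have zy: "trellis_equiv n (coord_trellis n J z \<sigma>) (coord_trellis n J y \<sigma>)"
      unfolding z_def using j kJ by (intro coord_equiv_transpose) (auto simp: s_def)
    have zx: "trellis_equiv n (coord_trellis n J z \<sigma>) (coord_trellis n J x \<sigma>)"
      using trellis_equiv_trans[OF n zy yx] .
    have z: "z i = (if i = j then x' j else if i = k then x j else x i)" for i
      by (auto simp: z_def y_def transpose_def)
    have famz: "span_family n J z \<sigma>"
      using fam fam' j kJ unfolding span_family_def z by (auto simp: s_def)
    have Cz: "C t = vec.span (z ` {j \<in> J. span_le n (\<sigma> j) t})" if t: "valid_span n t" for t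
      using Cspan_eq_of_equiv_coord[OF n linear_coord_trellis edges_coord_subset zx, of t]
        C[OF t] Cspan_coord[OF n fam t] Cspan_coord[OF n famz t] by simp
    have "{i \<in> J. z i \<noteq> x' i} \<subset> {i \<in> J. x i \<noteq> x' i}"
      using j k by (auto simp: z P_def)
    then have "card {i \<in> J. z i \<noteq> x' i} < card {i \<in> J. x i \<noteq> x' i}"
      using fin by (intro psubset_card_mono) auto
    then have "trellis_equiv n (coord_trellis n J z \<sigma>) (coord_trellis n J x' \<sigma>)"
      using less.hyps famz Cz by blast
    then show ?thesis
      using trellis_equiv_trans[OF n trellis_equiv_sym[OF n zx]] by blast
  qed
qed

section \<open>Existence of elementary factorizations\<close>

text \<open>Addition of cycles comes from functions and pairs; only the scalar multiplication has to
  be supplied.\<close>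

definition cycle_scale ::
  "('a::field \<Rightarrow> 'v \<Rightarrow> 'v) \<Rightarrow> 'a \<Rightarrow> (nat \<Rightarrow> 'v) \<times> (nat \<Rightarrow> 'a) \<Rightarrow> (nat \<Rightarrow> 'v) \<times> (nat \<Rightarrow> 'a)" where
  "cycle_scale scale c p = (\<lambda>i. scale c (fst p i), \<lambda>i. c * snd p i)"

lemma cycle_scale_apply [simp]:
  "fst (cycle_scale scale c p) i = scale c (fst p i)" "snd (cycle_scale scale c p) i = c * snd p i"
  by (simp_all add: cycle_scale_def)

lemma vector_space_cycle_scale:
  assumes "vector_space scale"
  shows "vector_space (cycle_scale scale)"
proof -
  interpret vector_space scale by fact
  show ?thesis
    by unfold_locales
      (auto simp: prod_eq_iff fun_eq_iff scale_right_distrib scale_left_distrib algebra_simps)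
qed

lemma shift_mod_inverse: "(k::nat) < n \<Longrightarrow> a < n \<Longrightarrow> ((a + k) mod n + n - a) mod n = k"
proof -
  assume *: "k < n" "a < n"
  show ?thesis
  proof (cases "a + k < n")
    case False
    then have "(a + k) mod n = a + k - n" using * by (simp add: mod_if)
    with * False show ?thesis by simp
  qed (use * in simp)
qed

text \<open>Either some active vertex of \<open>(a, l)\<close> is inactive in \<open>s'\<close>, and
  \<open>c\<close> can be cut there, or only the label at \<open>a\<close> is missing from
  \<open>s'\<close>. In that case the whole edge at \<open>a\<close> vanishes, which gives the cut
  \<open>b = 1\<close> if \<open>l > 0\<close> and a vanishing arc if \<open>l = 0\<close>.\<close>

lemma not_span_le_cut:
  assumes n: "0 < n" and val: "a < n" "l < n" "valid_span n s'"
    and nle: "\<not> span_le n (Sp a l) s'" and sp: "cycle_has_span n s' c"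
  shows "(l = 0 \<and> fst c a = 0 \<and> snd c a = 0 \<and> fst c (nxt n a) = 0) \<or>
         (\<exists>b. 1 \<le> b \<and> b \<le> l \<and> fst c ((a + b) mod n) = 0)"
proof (cases "ioc n a l \<subseteq> active n s'")
  case False
  then obtain b where b: "1 \<le> b" "b \<le> l" "(a + b) mod n \<notin> active n s'" by (auto simp: ioc_def)
  then have "fst c ((a + b) mod n) = 0"
    using sp mod_less_divisor[OF n, of "a + b"] by (auto simp only: cycle_has_span_iff)
  then show ?thesis using b by blast
next
  case True
  then have "\<not> icc n a l \<subseteq> lab n s'" using nle n val by (simp add: span_le_iff)
  then have a: "a \<notin> lab n s'"
    using True icc_eq_insert[of a n l] active_subset_lab[of n s'] val by auto
  then have "a \<notin> active n s'" using active_subset_lab[of n s'] by auto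
  with a have "fst c a = 0" "snd c a = 0" using sp val by (auto simp: cycle_has_span_iff)
  moreover have "nxt n a \<notin> active n s'" using nxt_active_lab[of a n s'] a val by auto
  then have "fst c (nxt n a) = 0" using sp nxt_less[OF n] by (auto simp: cycle_has_span_iff)
  moreover have "nxt n a = (a + 1) mod n" by (simp add: nxt_def)
  ultimately show ?thesis by (cases "l = 0") (auto intro!: exI[of _ 1])
qed

locale reduced_trellis =
  fixes n :: nat and scale :: "'a::{field,finite} \<Rightarrow> 'v::ab_group_add \<Rightarrow> 'v" and T :: "('v, 'a) trellis"
  assumes trellis: "is_trellis n T" and linear: "linear_trellis n scale T" and reduced: "reduced n T"
begin

sublocale vert: vector_space scale using linear by (simp add: linear_trellis_def)
sublocale cyc: vector_space "cycle_scale scale" by (rule vector_space_cycle_scale) unfold_locales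

lemma n_pos: "0 < n" using trellis by (simp add: is_trellis_def)

lemma edges_subset: "i < n \<Longrightarrow> edges T i \<subseteq> verts T i \<times> UNIV \<times> verts T (nxt n i)"
  using trellis by (simp add: is_trellis_def)

lemma edge_zero: "i < n \<Longrightarrow> (0, 0, 0) \<in> edges T i"
  using linear by (simp add: linear_trellis_def)

lemma edge_add:
  "i < n \<Longrightarrow> (v, a, w) \<in> edges T i \<Longrightarrow> (v', a', w') \<in> edges T i \<Longrightarrow>
    (v + v', a + a', w + w') \<in> edges T i"
  using linear unfolding linear_trellis_def by blast

lemma edge_scale:
  "i < n \<Longrightarrow> (v, a, w) \<in> edges T i \<Longrightarrow> (scale c v, c * a, scale c w) \<in> edges T i"
  using linear unfolding linear_trellis_def by blast

definition S :: "span \<Rightarrow> ((nat \<Rightarrow> 'v) \<times> (nat \<Rightarrow> 'a)) set" where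
  "S s = {c \<in> cycles n T. cycle_has_span n s c}"

lemma S_iff:
  "c \<in> S s \<longleftrightarrow> (\<forall>k\<ge>n. fst c k = 0 \<and> snd c k = 0) \<and>
     (\<forall>i<n. (fst c i, snd c i, fst c (nxt n i)) \<in> edges T i) \<and>
     (\<forall>i<n. (fst c i \<noteq> 0 \<longrightarrow> i \<in> active n s) \<and> (snd c i \<noteq> 0 \<longrightarrow> i \<in> lab n s))"
  by (auto simp: S_def cycles_def cycle_has_span_iff)

lemma S_Full: "S Full = cycles n T"
  by (auto simp: S_def cycle_has_span_iff)

lemma S_Emp: "S Emp = {0}"
proof -
  have "c = 0" if "c \<in> S Emp" for c
    using that unfolding S_iff by (auto simp: prod_eq_iff fun_eq_iff) (metis not_le)+
  moreover have "0 \<in> S Emp" using edge_zero by (simp add: S_iff)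
  ultimately show ?thesis by blast
qed

lemma subspace_S: "cyc.subspace (S s)"
proof (rule cyc.subspaceI)
  show "0 \<in> S s" using edge_zero by (simp add: S_iff)
  show "c + d \<in> S s" if "c \<in> S s" "d \<in> S s" for c d
    using that edge_add unfolding S_iff by auto
  show "cycle_scale scale k c \<in> S s" if "c \<in> S s" for k c
    using that edge_scale unfolding S_iff by auto
qed

lemma finite_cycles: "finite (cycles n T)"
proof -
  let ?V = "{f. \<forall>i. (i \<in> {..<n} \<longrightarrow> f i \<in> (\<Union>i<n. verts T i)) \<and> (i \<notin> {..<n} \<longrightarrow> f i = 0)}"
  let ?A = "{f :: nat \<Rightarrow> 'a. \<forall>i. (i \<in> {..<n} \<longrightarrow> f i \<in> UNIV) \<and> (i \<notin> {..<n} \<longrightarrow> f i = 0)}"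
  have "cycles n T \<subseteq> ?V \<times> ?A"
  proof (clarify, intro conjI CollectI allI impI SigmaI)
    fix v a i assume c: "(v, a) \<in> cycles n T"
    show "v i \<in> (\<Union>i<n. verts T i)" if i: "i \<in> {..<n}"
    proof -
      have "(v i, a i, v (nxt n i)) \<in> edges T i" using c i by (simp add: cycles_def)
      then show ?thesis using edges_subset[of i] i by auto
    qed
  qed (auto simp: cycles_def)
  moreover have "finite ?V"
    using trellis by (intro finite_set_of_finite_funs) (auto simp: is_trellis_def)
  moreover have "finite ?A"
    by (intro finite_set_of_finite_funs) auto
  ultimately show ?thesis using finite_subset by blast
qed

text \<open>A path from zero to zero along the arc is closed up by zero edges. If
  \<open>l = n - 1\<close>, positions \<open>0\<close> and \<open>l + 1\<close> are the same index,
  which is consistent because \<open>p\<close> is zero at both.\<close>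

lemma glue_arc:
  assumes a: "a < n" "l < n" and e: "\<And>k. k \<le> l \<Longrightarrow> (p k, q k, p (Suc k)) \<in> edges T ((a + k) mod n)"
    and p: "p 0 = 0" "p (Suc l) = 0"
  obtains c where "c \<in> cycles n T" "\<And>k. k < n \<Longrightarrow> fst c ((a + k) mod n) = (if k \<le> l then p k else 0)"
    "\<And>k. k < n \<Longrightarrow> snd c ((a + k) mod n) = (if k \<le> l then q k else 0)"
proof -
  define pos where "pos i = (i + n - a) mod n" for i
  have pos: "pos ((a + k) mod n) = k" if "k < n" for k
    unfolding pos_def using shift_mod_inverse[OF that a(1)] .
  define v where "v i = (if i < n \<and> pos i \<le> l then p (pos i) else 0)" for i
  define \<alpha> where "\<alpha> i = (if i < n \<and> pos i \<le> l then q (pos i) else 0)" for i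
  have v: "v ((a + k) mod n) = (if k \<le> l then p k else 0)"
    and \<alpha>: "\<alpha> ((a + k) mod n) = (if k \<le> l then q k else 0)" if "k < n" for k
    using that n_pos by (auto simp: v_def \<alpha>_def pos)
  have vn: "v ((a + Suc k) mod n) = (if k \<le> l then p (Suc k) else 0)" if "k < n" for k
  proof (cases "Suc k = n")
    case True
    then have "(a + Suc k) mod n = (a + 0) mod n" by simp
    then have "v ((a + Suc k) mod n) = 0" using v[of 0] n_pos p by (simp only:) auto
    moreover have "k \<le> l \<Longrightarrow> k = l" using True a by simp
    ultimately show ?thesis using p by auto
  next
    case False
    have "Suc k \<le> l \<or> k = l \<or> l < k" by linarith
    then show ?thesis using v[of "Suc k"] False that p by auto
  qed
  have "(v i, \<alpha> i, v (nxt n i)) \<in> edges T i" if i: "i < n" for i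
  proof -
    obtain k where k: "k < n" "i = (a + k) mod n" using shift_mod_surj[OF i a(1)] by blast
    then show ?thesis using e[of k] edge_zero[OF i] n_pos
      by (simp add: nxt_shift v \<alpha> vn del: add_Suc_right)
  qed
  then have "(v, \<alpha>) \<in> cycles n T" by (auto simp: cycles_def v_def \<alpha>_def)
  with that[of "(v, \<alpha>)"] v \<alpha> show thesis by simp
qed

text \<open>Both paths run along the arc of \<open>(a, l)\<close>, the first with zero last edge and the second with
  zero first edge. The two ends of the arc are separate positions even if \<open>l = n - 1\<close>, where they
  are the same index.\<close>

definition splits :: "nat \<Rightarrow> nat \<Rightarrow> (nat \<Rightarrow> 'v) \<times> (nat \<Rightarrow> 'a) \<Rightarrow> bool" where
  "splits a l c \<longleftrightarrow> (\<exists>p q p' q'.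
     (\<forall>k\<le>l. (p k, q k, p (Suc k)) \<in> edges T ((a + k) mod n)) \<and>
     (\<forall>k\<le>l. (p' k, q' k, p' (Suc k)) \<in> edges T ((a + k) mod n)) \<and>
     (\<forall>k\<le>Suc l. fst c ((a + k) mod n) = p k + p' k) \<and>
     (\<forall>k\<le>l. snd c ((a + k) mod n) = q k + q' k) \<and>
     p l = 0 \<and> q l = 0 \<and> p (Suc l) = 0 \<and> p' 0 = 0 \<and> q' 0 = 0 \<and> p' (Suc 0) = 0)"

text \<open>Linearity is the purpose of \<open>splits\<close>: it passes from basis cycles to their
  combinations. It looks at the arc only, since the basis cycles may run beyond the arc even when
  their combination does not.\<close>

lemma subspace_splits: "cyc.subspace {c. splits a l c}"
proof (rule cyc.subspaceI)
  have mod: "k mod n < n" for k using n_pos by simp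
  show "0 \<in> {c. splits a l c}"
    unfolding splits_def mem_Collect_eq
    by (intro exI[of _ "\<lambda>_. 0"]) (simp add: edge_zero n_pos)
  fix c assume "c \<in> {c. splits a l c}"
  then obtain p q p' q' where c:
     "\<forall>k\<le>l. (p k, q k, p (Suc k)) \<in> edges T ((a + k) mod n)"
     "\<forall>k\<le>l. (p' k, q' k, p' (Suc k)) \<in> edges T ((a + k) mod n)"
     "\<forall>k\<le>Suc l. fst c ((a + k) mod n) = p k + p' k"
     "\<forall>k\<le>l. snd c ((a + k) mod n) = q k + q' k"
     "p l = 0 \<and> q l = 0 \<and> p (Suc l) = 0 \<and> p' 0 = 0 \<and> q' 0 = 0 \<and> p' (Suc 0) = 0"
    unfolding splits_def by blast
  {
    fix m
    show "cycle_scale scale m c \<in> {c. splits a l c}"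
      unfolding splits_def mem_Collect_eq
      apply (rule exI[of _ "\<lambda>k. scale m (p k)"], rule exI[of _ "\<lambda>k. m * q k"])
      apply (rule exI[of _ "\<lambda>k. scale m (p' k)"], rule exI[of _ "\<lambda>k. m * q' k"])
      using c mod by (auto intro!: edge_scale simp: vert.scale_right_distrib algebra_simps)
  }
  fix d assume "d \<in> {c. splits a l c}"
  then obtain r s r' s' where d:
     "\<forall>k\<le>l. (r k, s k, r (Suc k)) \<in> edges T ((a + k) mod n)"
     "\<forall>k\<le>l. (r' k, s' k, r' (Suc k)) \<in> edges T ((a + k) mod n)"
     "\<forall>k\<le>Suc l. fst d ((a + k) mod n) = r k + r' k"
     "\<forall>k\<le>l. snd d ((a + k) mod n) = s k + s' k"
     "r l = 0 \<and> s l = 0 \<and> r (Suc l) = 0 \<and> r' 0 = 0 \<and> s' 0 = 0 \<and> r' (Suc 0) = 0"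
    unfolding splits_def by blast
  show "c + d \<in> {c. splits a l c}"
    unfolding splits_def mem_Collect_eq
    apply (rule exI[of _ "\<lambda>k. p k + r k"], rule exI[of _ "\<lambda>k. q k + s k"])
    apply (rule exI[of _ "\<lambda>k. p' k + r' k"], rule exI[of _ "\<lambda>k. q' k + s' k"])
    using c d mod by (auto intro!: edge_add simp: algebra_simps)
qed

lemma splits_of_not_span_le:
  assumes a: "a < n" "l < n" "valid_span n s'" and nle: "\<not> span_le n (Sp a l) s'"
    and c: "c \<in> S s'"
  shows "splits a l c"
proof -
  have z: "(0, 0, 0) \<in> edges T ((a + k) mod n)" for k using edge_zero n_pos by simp
  have e: "(fst c ((a + k) mod n), snd c ((a + k) mod n), fst c ((a + Suc k) mod n))
      \<in> edges T ((a + k) mod n)" for k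
  proof -
    have "(a + k) mod n < n" using n_pos by simp
    then show ?thesis using c nxt_shift[of n a k] unfolding S_iff by metis
  qed
  have "cycle_has_span n s' c" using c by (simp add: S_def)
  from not_span_le_cut[OF n_pos a nle this] show ?thesis
  proof (elim disjE exE conjE)
    assume "l = 0" "fst c a = 0" "snd c a = 0" "fst c (nxt n a) = 0"
    moreover from this have "fst c ((a + k) mod n) = 0" if "k \<le> Suc l" for k
      using that a(1) by (cases k) (auto simp: nxt_def)
    ultimately show ?thesis unfolding splits_def using edge_zero[OF a(1)] a(1)
      by (intro exI[of _ "\<lambda>_. 0"]) simp
  next
    fix b assume b: "1 \<le> b" "b \<le> l" "fst c ((a + b) mod n) = 0"
    \<comment> \<open>The path \<open>p\<close> follows \<open>c\<close> up to the zero vertex at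
      position \<open>b\<close> and \<open>p'\<close> follows it from there on. By
      \<open>1 \<le> b\<close> the first edge of \<open>p'\<close> is zero, and by
      \<open>b \<le> l\<close> so is the last edge of \<open>p\<close>.\<close>
    define p where "p k = (if k < b then fst c ((a + k) mod n) else 0)" for k
    define q where "q k = (if k < b then snd c ((a + k) mod n) else 0)" for k
    define p' where "p' k = (if k < b then 0 else fst c ((a + k) mod n))" for k
    define q' where "q' k = (if k < b then 0 else snd c ((a + k) mod n))" for k
    have "(p k, q k, p (Suc k)) \<in> edges T ((a + k) mod n)" for k
    proof -
      consider "Suc k < b" | "Suc k = b" | "b \<le> k" by linarith
      then show ?thesis
        by cases (use e[of k] z[of k] b in \<open>simp_all add: p_def q_def del: add_Suc_right\<close>)
    qed
    moreover have "(p' k, q' k, p' (Suc k)) \<in> edges T ((a + k) mod n)" for k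
    proof -
      consider "Suc k < b" | "Suc k = b" | "b \<le> k" by linarith
      then show ?thesis
        by cases (use e[of k] z[of k] b in \<open>simp_all add: p'_def q'_def del: add_Suc_right\<close>)
    qed
    moreover have "p' (Suc 0) = 0" using b by (cases "b = 1") (auto simp: p'_def)
    ultimately show ?thesis unfolding splits_def
      using b by (intro exI[of _ p] exI[of _ q] exI[of _ p'] exI[of _ q'])
        (auto simp: p_def q_def p'_def q'_def)
  qed
qed

lemma less_span_butlast:
  assumes "a < n" "l < n" "0 < l"
  shows "span_less n (Sp a (l - 1)) (Sp a l)"
  using assms n_pos by (auto simp: span_less_def span_le_iff icc_def ioc_def)

lemma less_span_tl:
  assumes "a < n" "l < n" "0 < l"
  shows "span_less n (Sp (nxt n a) (l - 1)) (Sp a l)"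
proof -
  have eq: "(nxt n a + k) mod n = (a + Suc k) mod n" for k
    by (simp add: nxt_def mod_simps)
  have "ioc n (nxt n a) (l - 1) \<subseteq> ioc n a l" "icc n (nxt n a) (l - 1) \<subseteq> icc n a l"
    using assms by (auto simp: ioc_def icc_def eq simp del: add_Suc_right)
  then show ?thesis using assms n_pos nxt_less[OF n_pos, of a]
    by (auto simp: span_less_def span_le_iff)
qed

text \<open>Here \<open>c\<close> does have span \<open>(a, l)\<close>, so it is zero at both ends
  of the arc. Hence both paths start and end at zero and close up to cycles. The one without last
  edge has span \<open>(a, l - 1)\<close>, the one without first edge \<open>(a + 1, l - 1)\<close>;
  for \<open>l = 0\<close> both are zero.\<close>

lemma splits_in_lower:
  assumes a: "a < n" "l < n" and c: "c \<in> S (Sp a l)" and "splits a l c"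
  obtains s s' d d' where "valid_span n s" "span_less n s (Sp a l)" "d \<in> S s"
    "valid_span n s'" "span_less n s' (Sp a l)" "d' \<in> S s'" "c = d + d'"
proof -
  obtain p q p' q' where pq:
     "\<And>k. k \<le> l \<Longrightarrow> (p k, q k, p (Suc k)) \<in> edges T ((a + k) mod n)"
     "\<And>k. k \<le> l \<Longrightarrow> (p' k, q' k, p' (Suc k)) \<in> edges T ((a + k) mod n)"
     "\<And>k. k \<le> Suc l \<Longrightarrow> fst c ((a + k) mod n) = p k + p' k"
     "\<And>k. k \<le> l \<Longrightarrow> snd c ((a + k) mod n) = q k + q' k"
     "p l = 0" "q l = 0" "p (Suc l) = 0" "p' 0 = 0" "q' 0 = 0" "p' (Suc 0) = 0"
    using assms(4) unfolding splits_def by blast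
  have outside: "(a + k) mod n \<notin> icc n a l" if "l < k" "k < n" for k
    using inj_onD[OF inj_on_shift_mod[of a n], of k] that a(2) by (fastforce simp: icc_def)
  have cz: "fst c ((a + k) mod n) = 0" "snd c ((a + k) mod n) = 0" if "l < k" "k < n" for k
    using c outside[OF that] ioc_subset_icc[of n a l] mod_less_divisor[OF n_pos, of "a + k"]
    by (auto simp only: S_iff active_simps lab_simps)
  have "fst c a = 0"
    using c start_notin_ioc[OF a] a by (auto simp: S_iff)
  then have p0: "p 0 = 0" using pq(3)[of 0] pq(8) a by simp
  \<comment> \<open>The position after the arc lies outside it, except for \<open>l = n - 1\<close>,
    where it is the index \<open>a\<close> again.\<close>
  have "fst c ((a + Suc l) mod n) = 0"
  proof (cases "Suc l < n")
    case True
    then show ?thesis using cz(1)[of "Suc l"] by simp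
  next
    case False
    then have "Suc l = n" using a by simp
    then have "(a + Suc l) mod n = a" using a by simp
    then show ?thesis using \<open>fst c a = 0\<close> by simp
  qed
  then have p'l: "p' (Suc l) = 0" using pq(3)[of "Suc l"] pq(7) by simp
  obtain d where d: "d \<in> cycles n T" "\<And>k. k < n \<Longrightarrow> fst d ((a + k) mod n) = (if k \<le> l then p k else 0)"
    "\<And>k. k < n \<Longrightarrow> snd d ((a + k) mod n) = (if k \<le> l then q k else 0)"
    using glue_arc[where p = p and q = q, OF a pq(1) p0 pq(7)] by blast
  obtain d' where d': "d' \<in> cycles n T" "\<And>k. k < n \<Longrightarrow> fst d' ((a + k) mod n) = (if k \<le> l then p' k else 0)"
    "\<And>k. k < n \<Longrightarrow> snd d' ((a + k) mod n) = (if k \<le> l then q' k else 0)"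
    using glue_arc[where p = p' and q = q', OF a pq(2) pq(8) p'l] by blast
  have sum: "c = d + d'"
  proof -
    have "fst c i = fst d i + fst d' i \<and> snd c i = snd d i + snd d' i" for i
    proof (cases "i < n")
      case True
      then obtain k where k: "k < n" "i = (a + k) mod n" using shift_mod_surj a(1) by blast
      show ?thesis
      proof (cases "k \<le> l")
        case True
        then show ?thesis using k pq(3)[of k] pq(4)[of k] d d' by simp
      next
        case False
        then show ?thesis using k cz[of k] d d' by simp
      qed
    next
      case False
      then show ?thesis using c d(1) d'(1) by (auto simp: S_iff cycles_def)
    qed
    then show ?thesis by (auto simp: prod_eq_iff fun_eq_iff)
  qed
  show thesis
  proof (cases "l = 0")
    case True
    have "d \<in> S Emp"
      unfolding S_def cycle_has_span_iff
    proof (intro CollectI conjI d(1) allI impI)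
      fix i assume i: "i < n"
      then obtain k where k: "k < n" "i = (a + k) mod n" using shift_mod_surj a(1) by blast
      show "fst d i \<noteq> 0 \<Longrightarrow> i \<in> active n Emp" "snd d i \<noteq> 0 \<Longrightarrow> i \<in> lab n Emp"
        using d(2,3)[OF k(1)] k pq(5,6) True by (auto split: if_splits)
    qed
    moreover have "d' \<in> S Emp"
      unfolding S_def cycle_has_span_iff
    proof (intro CollectI conjI d'(1) allI impI)
      fix i assume i: "i < n"
      then obtain k where k: "k < n" "i = (a + k) mod n" using shift_mod_surj a(1) by blast
      show "fst d' i \<noteq> 0 \<Longrightarrow> i \<in> active n Emp" "snd d' i \<noteq> 0 \<Longrightarrow> i \<in> lab n Emp"
        using d'(2,3)[OF k(1)] k pq(8,9) True by (auto split: if_splits)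
    qed
    moreover have "span_less n Emp (Sp a l)" by (simp add: span_less_def span_le_def)
    ultimately show ?thesis using that[of Emp d Emp d'] sum by simp
  next
    case False
    have "d \<in> S (Sp a (l - 1))"
      unfolding S_def cycle_has_span_iff
    proof (intro CollectI conjI d(1) allI impI)
      fix i assume i: "i < n"
      then obtain k where k: "k < n" "i = (a + k) mod n" using shift_mod_surj a(1) by blast
      show "i \<in> active n (Sp a (l - 1))" if "fst d i \<noteq> 0"
      proof -
        have "k \<le> l" "p k \<noteq> 0" using that k d(2)[OF k(1)] by (auto split: if_splits)
        then have "k \<noteq> 0" "k \<noteq> l" using p0 pq(5) by metis+
        then show ?thesis using k \<open>k \<le> l\<close> by (auto simp: ioc_def intro!: exI[of _ k])
      qed
      show "i \<in> lab n (Sp a (l - 1))" if "snd d i \<noteq> 0"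
      proof -
        have "k \<le> l" "q k \<noteq> 0" using that k d(3)[OF k(1)] by (auto split: if_splits)
        then have "k \<noteq> l" using pq(6) by metis
        then show ?thesis using k \<open>k \<le> l\<close> by (auto simp: icc_def intro!: exI[of _ k])
      qed
    qed
    moreover have "d' \<in> S (Sp (nxt n a) (l - 1))"
      unfolding S_def cycle_has_span_iff
    proof (intro CollectI conjI d'(1) allI impI)
      fix i assume i: "i < n"
      then obtain k where k: "k < n" "i = (a + k) mod n" using shift_mod_surj a(1) by blast
      have eq: "i = (nxt n a + (k - 1)) mod n" if "k \<noteq> 0"
      proof -
        have "(nxt n a + (k - 1)) mod n = (Suc a + (k - 1)) mod n" by (simp only: nxt_def mod_add_left_eq)
        then show ?thesis using that k by simp
      qed
      show "i \<in> active n (Sp (nxt n a) (l - 1))" if "fst d' i \<noteq> 0"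
      proof -
        have "k \<le> l" "p' k \<noteq> 0" using that k d'(2)[OF k(1)] by (auto split: if_splits)
        then have "k \<noteq> 0" "k \<noteq> Suc 0" using pq(8,10) by metis+
        then show ?thesis using eq \<open>k \<le> l\<close> by (auto simp: ioc_def intro!: exI[of _ "k - 1"])
      qed
      show "i \<in> lab n (Sp (nxt n a) (l - 1))" if "snd d' i \<noteq> 0"
      proof -
        have "k \<le> l" "q' k \<noteq> 0" using that k d'(3)[OF k(1)] by (auto split: if_splits)
        then have "k \<noteq> 0" using pq(9) by metis
        then show ?thesis using eq \<open>k \<le> l\<close> by (auto simp: icc_def intro!: exI[of _ "k - 1"])
      qed
    qed
    ultimately show ?thesis
      using that[of "Sp a (l - 1)" d "Sp (nxt n a) (l - 1)" d'] sum a False nxt_less[OF n_pos, of a]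
        less_span_butlast[OF a] less_span_tl[OF a] by simp
  qed
qed

text \<open>Adding spans in order of rank ensures that no basis cycle chosen earlier has a span
  above the new \<open>s\<close>. Therefore every cycle of span \<open>s\<close> in the space
  generated so far splits into cycles of smaller span, to which the induction hypothesis
  applies.\<close>

lemma adapted_basis:
  assumes "finite A" "\<And>s. s \<in> A \<Longrightarrow> valid_span n s \<and> s \<noteq> Emp"
    and "\<And>s s'. s \<in> A \<Longrightarrow> valid_span n s' \<Longrightarrow> s' \<noteq> Emp \<Longrightarrow> span_less n s' s \<Longrightarrow> s' \<in> A"
  shows "\<exists>B \<sigma>. cyc.independent B \<and> (\<forall>b\<in>B. \<sigma> b \<in> A \<and> b \<in> S (\<sigma> b)) \<and>
           (\<forall>s\<in>A. S s \<subseteq> cyc.span {b \<in> B. span_le n (\<sigma> b) s})"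
  using assms
proof (induction A rule: finite_ranking_induct[where f = "span_rank n"])
  case empty
  show ?case by (intro exI[of _ "{}"]) (simp add: cyc.independent_empty)
next
  case (insert s A)
  show ?case
  proof (cases "s \<in> A")
    case True
    then have eq: "insert s A = A" by auto
    show ?thesis using insert.prems unfolding eq by (rule insert.IH)
  next
    case False
    have val: "valid_span n s" "s \<noteq> Emp" "\<And>t. t \<in> A \<Longrightarrow> valid_span n t \<and> t \<noteq> Emp"
      using insert.prems by auto
    \<comment> \<open>Since \<open>s\<close> has maximal rank, a span strictly below a member of
      \<open>A\<close> cannot be \<open>s\<close> itself.\<close>
    have closed: "t' \<in> A" if "t \<in> A" "valid_span n t'" "t' \<noteq> Emp" "span_less n t' t" for t t'
    proof -
      have "span_rank n t' < span_rank n s"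
        using span_less_rank[OF n_pos that(2) _ that(4)] val that insert.hyps(2)[of t] by fastforce
      then show ?thesis using insert.prems(2)[of t t'] that by auto
    qed
    have "\<exists>B \<sigma>. cyc.independent B \<and> (\<forall>b\<in>B. \<sigma> b \<in> A \<and> b \<in> S (\<sigma> b)) \<and>
        (\<forall>t\<in>A. S t \<subseteq> cyc.span {b \<in> B. span_le n (\<sigma> b) t})"
      by (rule insert.IH) (use val(3) closed in blast)+
    then obtain B \<sigma> where B: "cyc.independent B" "\<forall>b\<in>B. \<sigma> b \<in> A \<and> b \<in> S (\<sigma> b)"
      "\<forall>t\<in>A. S t \<subseteq> cyc.span {b \<in> B. span_le n (\<sigma> b) t}"
      by (elim exE conjE)
    note B = B(1) B(2)[rule_format] B(3)[rule_format]
    obtain B' where B': "B \<subseteq> B'" "B' \<subseteq> B \<union> S s" "cyc.independent B'" "B \<union> S s \<subseteq> cyc.span B'"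
      using cyc.maximal_independent_subset_extend[of B "B \<union> S s"] B(1) by blast
    define \<sigma>' where "\<sigma>' b = (if b \<in> B then \<sigma> b else s)" for b
    have mono: "{b \<in> B. span_le n (\<sigma> b) t} \<subseteq> {b \<in> B'. span_le n (\<sigma>' b) t}" for t
      using B'(1) by (auto simp: \<sigma>'_def)
    have old: "S t \<subseteq> cyc.span {b \<in> B'. span_le n (\<sigma>' b) t}" if "t \<in> A" for t
      using B(3)[OF that] cyc.span_mono[OF mono] by blast
    have lower: "S t \<subseteq> cyc.span {b \<in> B'. span_le n (\<sigma>' b) s}"
      if t: "valid_span n t" "span_less n t s" for t
    proof (cases "t = Emp")
      case True
      then show ?thesis by (simp add: S_Emp cyc.span_zero)
    next
      case ne: False
      then have tA: "t \<in> A" using insert.prems(2)[of s t] t by (auto simp: span_less_def)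
      have "span_le n (\<sigma>' b) s" if "b \<in> B'" "span_le n (\<sigma>' b) t" for b
      proof -
        have "valid_span n (\<sigma>' b)" using B(2) val by (auto simp: \<sigma>'_def)
        then show ?thesis using span_le_trans[OF n_pos _ t(1) val(1)] that t by (auto simp: span_less_def)
      qed
      then have "cyc.span {b \<in> B'. span_le n (\<sigma>' b) t} \<subseteq> cyc.span {b \<in> B'. span_le n (\<sigma>' b) s}"
        by (intro cyc.span_mono) auto
      then show ?thesis using old[OF tA] by blast
    qed
    have new: "S s \<subseteq> cyc.span {b \<in> B'. span_le n (\<sigma>' b) s}"
    proof
      fix c assume c: "c \<in> S s"
      \<comment> \<open>Subtracting the part \<open>y\<close> generated by the new vectors, all of
        span \<open>s\<close>, leaves a cycle \<open>x\<close> of span \<open>s\<close> that is a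
        combination of old vectors.\<close>
      have "c \<in> cyc.span (B \<union> (B' - B))" using B' c by (auto simp: Un_absorb1)
      then obtain x y where xy: "c = x + y" "x \<in> cyc.span B" "y \<in> cyc.span (B' - B)"
        unfolding cyc.span_Un by blast
      have "y \<in> S s"
        using cyc.span_minimal[OF _ subspace_S, of "B' - B" s] B'(2) xy(3) by blast
      then have xS: "x \<in> S s"
        using cyc.subspace_diff[OF subspace_S c] xy(1) by (metis add_diff_cancel_right')
      have "B' - B \<subseteq> {b \<in> B'. span_le n (\<sigma>' b) s}"
        using span_le_refl[OF n_pos val(1)] by (auto simp: \<sigma>'_def)
      then have y: "y \<in> cyc.span {b \<in> B'. span_le n (\<sigma>' b) s}"
        using cyc.span_mono xy(3) by blast
      have "x \<in> cyc.span {b \<in> B'. span_le n (\<sigma>' b) s}"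
      proof (cases s)
        case Full
        then have "B \<subseteq> {b \<in> B'. span_le n (\<sigma>' b) s}"
          using B'(1) n_pos B(2) val(3) by (auto simp: \<sigma>'_def span_le_iff)
        then show ?thesis using xy(2) cyc.span_mono by blast
      next
        case (Sp a l)
        have al: "a < n" "l < n" using val Sp by auto
        have "B \<subseteq> {c. splits a l c}"
        proof
          fix b assume "b \<in> B"
          then have b: "\<sigma> b \<in> A" "b \<in> S (\<sigma> b)" using B(2) by auto
          have "\<not> span_le n s (\<sigma> b)"
          proof
            assume "span_le n s (\<sigma> b)"
            then have "span_less n s (\<sigma> b)" using b False by (auto simp: span_less_def)
            then show False
              using span_less_rank[OF n_pos val(1)] val(3)[OF b(1)] insert.hyps(2)[OF b(1)] by fastforce
          qed
          then show "b \<in> {c. splits a l c}"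
            using splits_of_not_span_le[OF al, of "\<sigma> b" b] val(3)[OF b(1)] b(2) Sp by simp
        qed
        then have "splits a l x"
          using cyc.span_minimal[OF _ subspace_splits] xy(2) by blast
        then obtain t t' d d' where "valid_span n t" "span_less n t s" "d \<in> S t"
            "valid_span n t'" "span_less n t' s" "d' \<in> S t'" "x = d + d'"
          using splits_in_lower[OF al] xS Sp by metis
        then show ?thesis using lower cyc.span_add by blast
      qed (use val in simp)
      then show "c \<in> cyc.span {b \<in> B'. span_le n (\<sigma>' b) s}"
        using y xy(1) cyc.span_add by blast
    qed
    have mem: "\<sigma>' b \<in> insert s A \<and> b \<in> S (\<sigma>' b)" if "b \<in> B'" for b
      using B(2)[of b] B'(2) that by (auto simp: \<sigma>'_def)
    show ?thesis
      using B'(3) mem old new by (intro exI[of _ B'] exI[of _ \<sigma>']) blast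
  qed
qed

lemma fst_combination: "fst (\<Sum>b\<in>B. cycle_scale scale (k b) b) i = (\<Sum>b\<in>B. scale (k b) (fst b i))"
  by (simp add: fst_sum sum_fun_apply)

lemma snd_combination: "snd (\<Sum>b\<in>B. cycle_scale scale (k b) b) i = (\<Sum>b\<in>B. k b * snd b i)"
  by (simp add: snd_sum sum_fun_apply)

text \<open>An adapted basis \<open>B\<close> gives coordinates of cycles. A basis cycle whose span
  is inactive at \<open>i\<close> has zero vertex there, so a vertex depends only on the active
  coordinates, and these serve as its coordinates. Trimness and reducedness put every vertex and
  edge on a cycle.\<close>

theorem exists_elementary_factorization:
  "\<exists>(B :: ((nat \<Rightarrow> 'v) \<times> (nat \<Rightarrow> 'a)) set) \<sigma>.
     span_family n B snd \<sigma> \<and> trellis_equiv n (coord_trellis n B snd \<sigma>) T"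
proof -
  let ?A = "{s. valid_span n s \<and> s \<noteq> Emp}"
  have "finite ?A"
    by (rule finite_subset[OF _ finite_valid_spans[of n]]) auto
  then have "\<exists>B \<sigma>. cyc.independent B \<and> (\<forall>b\<in>B. \<sigma> b \<in> ?A \<and> b \<in> S (\<sigma> b)) \<and>
      (\<forall>s\<in>?A. S s \<subseteq> cyc.span {b \<in> B. span_le n (\<sigma> b) s})"
    by (rule adapted_basis) auto
  then obtain B \<sigma> where ind: "cyc.independent B"
    and B1: "\<forall>b\<in>B. \<sigma> b \<in> ?A \<and> b \<in> S (\<sigma> b)"
    and B2: "\<forall>s\<in>?A. S s \<subseteq> cyc.span {b \<in> B. span_le n (\<sigma> b) s}"
    by (elim exE conjE)
  have BS: "valid_span n (\<sigma> b) \<and> \<sigma> b \<noteq> Emp \<and> b \<in> S (\<sigma> b)" if "b \<in> B" for b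
    using B1 that by simp
  have span: "S s \<subseteq> cyc.span {b \<in> B. span_le n (\<sigma> b) s}" if "valid_span n s" "s \<noteq> Emp" for s
    using B2 that by simp
  have Bc: "B \<subseteq> cycles n T" using BS by (auto simp: S_def)
  have fin: "finite B" using finite_subset[OF Bc finite_cycles] .
  have fam: "span_family n B snd \<sigma>"
    unfolding span_family_def
  proof (intro conjI ballI allI impI)
    fix b assume b: "b \<in> B"
    show "is_vec n (snd b)" "vec_has_span n (\<sigma> b) (snd b)"
      using BS[OF b] by (auto simp: S_iff is_vec_def vec_has_span_iff)
  next
    fix b b' a assume b: "b \<in> B" "b' \<in> B" "\<sigma> b = Sp a 0" "\<sigma> b' = Sp a 0"
    have an: "a < n" using BS[OF b(1)] b(3) by simp
    \<comment> \<open>A cycle of span \<open>(a, 0)\<close> is determined by its label at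
      \<open>a\<close>, so two of them are proportional and cannot both belong to a basis.\<close>
    have zero: "fst c i = 0" "i \<noteq> a \<Longrightarrow> snd c i = 0" if "c \<in> S (Sp a 0)" for c i
    proof -
      have "icc n a 0 = {a}" "ioc n a 0 = {}" using an by (auto simp: icc_def ioc_def)
      then show "fst c i = 0" "i \<noteq> a \<Longrightarrow> snd c i = 0"
        using that by (cases "i < n"; auto simp: S_iff)+
    qed
    have bS: "b \<in> S (Sp a 0)" "b' \<in> S (Sp a 0)" using BS b by metis+
    have "b \<noteq> 0" using cyc.dependent_zero ind b(1) by blast
    moreover have "b = 0" if "snd b a = 0"
    proof -
      have "snd b i = 0" for i using zero(2)[OF bS(1), of i] that by (cases "i = a") auto
      then show ?thesis using zero(1)[OF bS(1)] by (simp add: prod_eq_iff fun_eq_iff)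
    qed
    ultimately have nz: "snd b a \<noteq> 0" by blast
    show "b = b'"
    proof (rule ccontr)
      assume "b \<noteq> b'"
      define r where "r = snd b' a / snd b a"
      have r: "snd b' i = r * snd b i" for i
        using zero(2)[OF bS(1), of i] zero(2)[OF bS(2), of i] nz by (cases "i = a") (auto simp: r_def)
      have "b' = cycle_scale scale r b"
        using zero(1)[OF bS(1)] zero(1)[OF bS(2)] by (simp add: prod_eq_iff fun_eq_iff r)
      moreover have "b \<in> B - {b'}" using b \<open>b \<noteq> b'\<close> by simp
      then have "cycle_scale scale r b \<in> cyc.span (B - {b'})"
        by (intro cyc.span_scale cyc.span_base)
      ultimately have "b' \<in> cyc.span (B - {b'})" by (rule ssubst)
      then show False using ind b(2) by (auto simp: cyc.dependent_def)
    qed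
  qed (use fin BS in auto)
  define comb where "comb k = (\<Sum>b\<in>B. cycle_scale scale (k b) b)" for k
  define f where "f i v = (\<Sum>b\<in>B. scale (v b) (fst b i))" for i v
  have comb_cycle: "comb k \<in> cycles n T" for k
    unfolding comb_def using Bc subspace_S[of Full]
    by (auto simp: S_Full intro!: cyc.subspace_sum cyc.subspace_scale)
  have expand: "\<exists>k. c = comb k" if "c \<in> cycles n T" for c
  proof -
    have "c \<in> cyc.span B"
      using span[of Full] that cyc.span_mono[of "{b \<in> B. span_le n (\<sigma> b) Full}" B]
      by (auto simp: S_Full)
    then show ?thesis using cyc.span_image_finite[OF fin, of "\<lambda>b. b"] by (auto simp: comb_def)
  qed
  have fst_comb: "fst (comb k) i = f i (restr n B \<sigma> i k)" if "i < n" for i k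
    unfolding comb_def f_def fst_combination
  proof (rule sum.cong)
    fix b assume b: "b \<in> B"
    then have "i \<notin> active n (\<sigma> b) \<Longrightarrow> fst b i = 0" using BS[OF b] that by (auto simp: S_iff)
    then show "scale (k b) (fst b i) = scale (restr n B \<sigma> i k b) (fst b i)"
      using b by (auto simp: restr_def)
  qed simp
  have snd_comb: "snd (comb k) i = (\<Sum>b\<in>B. k b * snd b i)" for i k
    by (simp add: comb_def snd_combination)
  have inj: "v = w" if i: "i < n" and vw: "restr n B \<sigma> i v = v" "restr n B \<sigma> i w = w" "f i v = f i w"
    for i v w
  proof -
    \<comment> \<open>Two coordinate vectors with the same vertex at \<open>i\<close> differ by a
      cycle through zero at \<open>i\<close>, that is, a cycle of span \<open>(i, n - 1)\<close>.
      Adaptedness expands it in basis cycles below this span, none of which is active at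
      \<open>i\<close>.\<close>
    let ?s = "Sp i (n - 1)"
    have vs: "valid_span n ?s" using i by auto
    have "fst (comb (v - w)) i = f i v - f i w"
      unfolding comb_def f_def fst_combination by (simp add: vert.scale_left_diff_distrib sum_subtractf)
    then have "fst (comb (v - w)) i = 0" using vw by simp
    moreover have "j \<in> ioc n i (n - 1)" if "j < n" "j \<noteq> i" for j
      using icc_full[OF n_pos, of i] icc_eq_insert[OF i, of "n - 1"] that by auto
    ultimately have "comb (v - w) \<in> S ?s"
      using comb_cycle[of "v - w"] icc_full[OF n_pos, of i] unfolding S_def cycle_has_span_iff by auto
    then have "comb (v - w) \<in> cyc.span ((\<lambda>b. b) ` {b \<in> B. span_le n (\<sigma> b) ?s})"
      using span[OF vs] by auto
    then obtain e where e: "comb (v - w) = (\<Sum>b\<in>{b \<in> B. span_le n (\<sigma> b) ?s}. cycle_scale scale (e b) b)"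
      using cyc.span_image_finite[of "{b \<in> B. span_le n (\<sigma> b) ?s}" "\<lambda>b. b"] fin by auto
    define e' where "e' b = (if span_le n (\<sigma> b) ?s then e b else 0)" for b
    have "comb (v - w) = comb e'"
      unfolding e unfolding comb_def e'_def using fin by (intro sum.mono_neutral_cong_left) auto
    then have "(\<Sum>b\<in>B. cycle_scale scale ((v - w) b - e' b) b) = 0"
      unfolding comb_def by (simp add: cyc.scale_left_diff_distrib sum_subtractf)
    then have d: "(v - w) b = e' b" if "b \<in> B" for b
      using cyc.independentD[OF ind fin subset_refl _ that, of "\<lambda>b. (v - w) b - e' b"] by simp
    show "v = w"
    proof
      fix b
      have "v b = restr n B \<sigma> i v b" "w b = restr n B \<sigma> i w b" using vw by simp_all
      moreover have "v b = w b" if b: "b \<in> B" "i \<in> active n (\<sigma> b)"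
      proof -
        have "\<not> span_le n (\<sigma> b) ?s"
          using span_le_iff[OF n_pos _ vs] BS[OF b(1)] b(2) start_notin_ioc[OF i, of "n - 1"] n_pos by auto
        then show ?thesis using d[OF b(1)] by (simp add: e'_def)
      qed
      ultimately show "v b = w b" by (auto simp: restr_def split: if_splits)
    qed
  qed
  have cyc_edge: "(fst c i, snd c i, fst c (nxt n i)) \<in> edges T i" if "c \<in> cycles n T" "i < n" for c i
    using that by (auto simp: cycles_def)
  have nn: "nxt n i < n" for i using nxt_less[OF n_pos] .
  have bij: "bij_betw (f i) (verts (coord_trellis n B snd \<sigma>) i) (verts T i)" if i: "i < n" for i
  proof (rule bij_betw_imageI)
    show "inj_on (f i) (verts (coord_trellis n B snd \<sigma>) i)"
      using inj[OF i] by (auto simp: verts_coord_iff intro!: inj_onI)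
    show "f i ` verts (coord_trellis n B snd \<sigma>) i = verts T i"
    proof
      show "f i ` verts (coord_trellis n B snd \<sigma>) i \<subseteq> verts T i"
        using cyc_edge[OF comb_cycle i] edges_subset[OF i] fst_comb[OF i]
        by (auto simp: verts_coord)
      show "verts T i \<subseteq> f i ` verts (coord_trellis n B snd \<sigma>) i"
      proof
        fix v assume "v \<in> verts T i"
        then obtain a w where "(v, a, w) \<in> edges T i"
          using trellis i unfolding is_trellis_def by blast
        then obtain c where "c \<in> cycles n T" "fst c i = v"
          using reduced i by (fastforce simp: reduced_def)
        then obtain k where "v = f i (restr n B \<sigma> i k)" using expand fst_comb[OF i] by metis
        then show "v \<in> f i ` verts (coord_trellis n B snd \<sigma>) i" by (auto simp: verts_coord)
      qed
    qed
  qed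
  moreover have "(v, a, w) \<in> edges (coord_trellis n B snd \<sigma>) i \<longleftrightarrow>
      (f i v, a, f (nxt n i) w) \<in> edges T i"
    if i: "i < n" and vw: "v \<in> verts (coord_trellis n B snd \<sigma>) i"
      "w \<in> verts (coord_trellis n B snd \<sigma>) (nxt n i)" for i v a w
  proof
    assume "(v, a, w) \<in> edges (coord_trellis n B snd \<sigma>) i"
    then obtain k where k: "v = restr n B \<sigma> i k" "a = (\<Sum>b\<in>B. k b * snd b i)"
      "w = restr n B \<sigma> (nxt n i) k" by (auto simp: edges_coord)
    then show "(f i v, a, f (nxt n i) w) \<in> edges T i"
      using cyc_edge[OF comb_cycle i, of k] by (simp add: fst_comb i nn snd_comb)
  next
    assume "(f i v, a, f (nxt n i) w) \<in> edges T i"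
    then obtain c where "c \<in> cycles n T" "fst c i = f i v" "snd c i = a" "fst c (nxt n i) = f (nxt n i) w"
      using reduced i by (fastforce simp: reduced_def)
    then obtain k where k: "fst (comb k) i = f i v" "snd (comb k) i = a"
      "fst (comb k) (nxt n i) = f (nxt n i) w" using expand by metis
    have "v = restr n B \<sigma> i k"
      using inj[OF i _ _ k(1)[symmetric, unfolded fst_comb[OF i]]] vw by (simp add: verts_coord_iff)
    moreover have "w = restr n B \<sigma> (nxt n i) k"
      using inj[OF nn _ _ k(3)[symmetric, unfolded fst_comb[OF nn]]] vw by (simp add: verts_coord_iff)
    ultimately show "(v, a, w) \<in> edges (coord_trellis n B snd \<sigma>) i"
      using k(2) by (auto simp: edges_coord snd_comb)
  qed
  ultimately have "trellis_equiv n (coord_trellis n B snd \<sigma>) T"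
    unfolding trellis_equiv_def by blast
  with fam show ?thesis by blast
qed

end

section \<open>The factorization criterion\<close>

lemma (in vector_space) span_UN_subspaces:
  assumes "finite A" "\<And>s. s \<in> A \<Longrightarrow> subspace (C s)"
  shows "span (\<Union>s\<in>A. C s) = {\<Sum>s\<in>A. y s | y. \<forall>s\<in>A. y s \<in> C s}"
proof
  show "{\<Sum>s\<in>A. y s | y. \<forall>s\<in>A. y s \<in> C s} \<subseteq> span (\<Union>s\<in>A. C s)"
    by (auto intro!: span_sum intro: span_base)
  show "span (\<Union>s\<in>A. C s) \<subseteq> {\<Sum>s\<in>A. y s | y. \<forall>s\<in>A. y s \<in> C s}"
    using assms
  proof (induction A rule: finite_induct)
    case (insert a A)
    show ?case
    proof
      fix z assume "z \<in> span (\<Union>s\<in>insert a A. C s)"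
      then have "z \<in> span (C a \<union> (\<Union>s\<in>A. C s))" by simp
      then obtain u v where uv: "z = u + v" "u \<in> span (C a)" "v \<in> span (\<Union>s\<in>A. C s)"
        unfolding span_Un by blast
      moreover have "u \<in> C a" using uv(2) insert.prems[of a] span_minimal[of "C a" "C a"] by blast
      moreover obtain y where y: "v = (\<Sum>s\<in>A. y s)" "\<forall>s\<in>A. y s \<in> C s"
        using insert.IH insert.prems uv(3) by blast
      moreover have "(\<Sum>s\<in>A. (y(a := u)) s) = (\<Sum>s\<in>A. y s)"
        using insert.hyps by (intro sum.cong) auto
      ultimately have "z = (\<Sum>s\<in>insert a A. (y(a := u)) s)" "\<forall>s\<in>insert a A. (y(a := u)) s \<in> C s"
        using insert.hyps by auto
      then show "z \<in> {\<Sum>s\<in>insert a A. y s | y. \<forall>s\<in>insert a A. y s \<in> C s}" by blast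
    qed
  qed simp
qed

lemma lower_sum_eq_span:
  fixes T :: "('v::zero, 'a::field) trellis"
  assumes "\<And>s. valid_span n s \<Longrightarrow> vec.subspace (Cspan n T s)"
  shows "lower_sum n T s =
    vec.span (\<Union>s'\<in>{s'. valid_span n s' \<and> span_less n s' s}. Cspan n T s')"
proof -
  let ?A = "{s'. valid_span n s' \<and> span_less n s' s}"
  have fin: "finite ?A" by (rule finite_subset[OF _ finite_valid_spans[of n]]) auto
  have "vec.span (\<Union>s'\<in>?A. Cspan n T s') = {\<Sum>s'\<in>?A. y s' | y. \<forall>s'\<in>?A. y s' \<in> Cspan n T s'}"
    using fin assms by (intro vec.span_UN_subspaces) auto
  moreover have "(\<Sum>s'\<in>?A. y s') = (\<lambda>k. \<Sum>s'\<in>?A. y s' k)" for y :: "span \<Rightarrow> nat \<Rightarrow> 'a"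
    by (simp add: fun_eq_iff sum_fun_apply)
  ultimately show ?thesis by (simp add: lower_sum_def)
qed

lemma set_plus_vec_span: "set_plus_vec (vec.span A) (vec.span B) = vec.span (A \<union> B)"
  unfolding vec.span_Un set_plus_vec_def by (simp add: plus_fun_def)

lemma gen_space_eq_span: "gen_space m x = vec.span (x ` {1..m})"
  by (auto simp: gen_space_def vec_span_image_finite)

lemma image_mset_Sigma:
  assumes "finite A" "\<And>s. s \<in> A \<Longrightarrow> finite (B s)"
  shows "image_mset f (mset_set (Sigma A B)) = (\<Sum>s\<in>A. image_mset (\<lambda>i. f (s, i)) (mset_set (B s)))"
  using assms
proof (induction A rule: finite_induct)
  case (insert a A)
  have Sig: "Sigma (insert a A) B = Pair a ` B a \<union> Sigma A B" by auto
  have "mset_set (Pair a ` B a \<union> Sigma A B) = mset_set (Pair a ` B a) + mset_set (Sigma A B)"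
    using insert by (intro mset_set_Union) auto
  also have "mset_set (Pair a ` B a) = image_mset (Pair a) (mset_set (B a))"
    by (simp add: image_mset_mset_set inj_on_def)
  finally show ?case using insert by (simp add: Sig multiset.map_comp comp_def)
qed simp

text \<open>\<open>elem_prod_mset\<close> picks an unspecified list. Any list with the right
  multiset is an ordering of \<open>J\<close>, and the coordinate model depends on the set
  \<open>J\<close> alone.\<close>

lemma exists_enumeration:
  assumes "finite J" "mset fs = image_mset f (mset_set J)"
  obtains js where "distinct js" "set js = J" "map f js = fs"
proof -
  obtain ks where ks: "set ks = J" "distinct ks" using finite_distinct_list[OF assms(1)] by blast
  then have "mset fs = mset (map f ks)" using assms(2) by (simp add: mset_set_set[symmetric])
  then obtain p where p: "p permutes {..<length (map f ks)}" "permute_list p (map f ks) = fs"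
    using mset_eq_permutation by blast
  then have p': "p permutes {..<length ks}" by simp
  have "map f (permute_list p ks) = fs" using p' p(2) by (simp add: permute_list_map)
  moreover have "distinct (permute_list p ks)" "set (permute_list p ks) = J"
    using ks p' by simp_all
  ultimately show thesis using that by blast
qed

lemma exists_map_eq:
  assumes "distinct js" "length js = length ys"
  obtains g where "map g js = ys"
proof
  show "map (\<lambda>j. the (map_of (zip js ys) j)) js = ys"
    using assms by (intro nth_equalityI) (auto simp: map_of_zip_nth)
qed

lemma length_filter_family:
  assumes "distinct js"
  shows "length (filter (\<lambda>(x, s). s = t) (map (\<lambda>j. (x j, \<sigma> j)) js)) = card {j \<in> set js. \<sigma> j = t}"
proof -
  have "length (filter (\<lambda>(x, s). s = t) (map (\<lambda>j. (x j, \<sigma> j)) js)) = length (filter (\<lambda>j. \<sigma> j = t) js)"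
    by (simp add: filter_map comp_def)
  also have "\<dots> = card {j \<in> set js. \<sigma> j = t}"
    using distinct_card[of "filter (\<lambda>j. \<sigma> j = t) js"] assms by simp
  finally show ?thesis .
qed

text \<open>A factor \<open>0|(a, 0)\<close> is trivial, so the multiset of spans of a factorization is unique only up
  to spans \<open>(a, 0)\<close> with \<open>C\<^bsub>(a, 0)\<^esub>(T) = 0\<close>. The argument below works for each of these multisets.\<close>

lemma (in reduced_trellis) span_distribution_factorization:
  obtains fs where "is_elem_factorization n T fs" "span_distribution n T = mset (map snd fs)"
proof -
  obtain B :: "((nat \<Rightarrow> 'v) \<times> (nat \<Rightarrow> 'a)) set" and \<sigma> where fam: "span_family n B snd \<sigma>"
    and eq: "trellis_equiv n (coord_trellis n B snd \<sigma>) T"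
    using exists_elementary_factorization by blast
  have fin: "finite B" using fam by (simp add: span_family_def)
  obtain js where js: "set js = B" "distinct js" using finite_distinct_list[OF fin] by blast
  let ?fs = "map (\<lambda>j. (snd j, \<sigma> j)) js"
  have "trellis_equiv n T (elem_prod n ?fs)"
    using trellis_equiv_trans[OF n_pos trellis_equiv_sym[OF n_pos eq]]
      coord_equiv_elem_prod[OF js(2), of n snd \<sigma>] js(1) by blast
  moreover have "length (filter (\<lambda>(x, s). s = Sp a 0) ?fs) \<le> 1" for a
    unfolding length_filter_family[OF js(2)] js(1) One_nat_def
    using fam fin by (subst card_le_Suc0_iff_eq) (auto simp: span_family_def)
  moreover have "\<forall>(x, s)\<in>set ?fs. s \<noteq> Emp \<and> valid_span n s \<and> is_vec n x \<and> vec_has_span n s x"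
    using fam js by (auto simp: span_family_def)
  ultimately have "is_elem_factorization n T ?fs"
    by (simp only: is_elem_factorization_def) blast
  then have "\<exists>M fs. is_elem_factorization n T fs \<and> M = mset (map snd fs)" by blast
  from someI_ex[OF this] show thesis using that unfolding span_distribution_def by blast
qed

theorem mainTheorem10:
  fixes n :: nat
    and scale :: "'a::{field,finite} \<Rightarrow> 'v::ab_group_add \<Rightarrow> 'v"
    and T :: "('v, 'a) trellis"
    and alpha :: "span \<Rightarrow> nat \<Rightarrow> nat \<Rightarrow> 'a"
  assumes "is_trellis n T"
    and "linear_trellis n scale T"
    and "reduced n T"
    and "\<forall>s\<in>#span_distribution n T. \<forall>i\<in>{1..count (span_distribution n T) s}.
           is_vec n (alpha s i) \<and> vec_has_span n s (alpha s i)"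
  shows "trellis_equiv n T
           (elem_prod_mset n
              (\<Sum>s\<in>set_mset (span_distribution n T).
                 mset (map (\<lambda>i. (alpha s i, s)) [1..<Suc (count (span_distribution n T) s)])))
         \<longleftrightarrow>
         (\<forall>s\<in>#span_distribution n T.
            Cspan n T s = set_plus_vec (gen_space (count (span_distribution n T) s) (alpha s))
                                       (lower_sum n T s))"
proof -
  interpret reduced_trellis n scale T using assms(1-3) by unfold_locales
  define M where "M = span_distribution n T"
  obtain fs where fact: "is_elem_factorization n T fs" and M: "M = mset (map snd fs)"
    using span_distribution_factorization unfolding M_def by blast
  \<comment> \<open>The pairs \<open>(s, i)\<close> index both the known factorization and the
    prescribed vectors, with span map \<open>fst\<close>; the exchange compares families over a
    common index set.\<close>
  define J where "J = (SIGMA s:set_mset M. {1..count M s})"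
  define x' where "x' = (\<lambda>(s, i). alpha s i)"
  have fin: "finite J" by (simp add: J_def)
  have "image_mset fst (mset_set J) = M"
  proof (rule multiset_eqI)
    fix s
    have "fst -` {s} \<inter> J = Pair s ` {1..count M s}"
      by (cases "s \<in># M") (auto simp: J_def not_in_iff)
    then show "count (image_mset fst (mset_set J)) s = count M s"
    proof -
      have "(\<Sum>j\<in>fst -` {s} \<inter> J. count (mset_set J) j) = card (fst -` {s} \<inter> J)"
        using fin by (simp add: count_mset_set)
      also have "\<dots> = count M s"
        unfolding \<open>fst -` {s} \<inter> J = _\<close> by (simp add: card_image inj_on_def)
      finally show ?thesis using fin by (simp add: count_image_mset)
    qed
  qed
  then have "mset (map snd fs) = image_mset fst (mset_set J)" using M by simp
  then obtain js where js: "distinct js" "set js = J" "map fst js = map snd fs"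
    using exists_enumeration[OF fin] by blast
  have "length js = length (map fst fs)" using arg_cong[OF js(3), of length] by simp
  then obtain x where x: "map x js = map fst fs" using exists_map_eq[OF js(1)] by blast
  have fs: "fs = map (\<lambda>j. (x j, fst j)) js"
  proof (rule nth_equalityI)
    show len: "length fs = length (map (\<lambda>j. (x j, fst j)) js)"
      using arg_cong[OF js(3), of length] by simp
    fix i assume "i < length fs"
    with len show "fs ! i = map (\<lambda>j. (x j, fst j)) js ! i"
      using arg_cong[OF js(3), of "\<lambda>l. l ! i"] arg_cong[OF x, of "\<lambda>l. l ! i"]
      by (simp add: prod_eq_iff)
  qed
  have val: "valid_span n (fst j) \<and> fst j \<noteq> Emp \<and> is_vec n (x j) \<and> vec_has_span n (fst j) (x j)"
    if "j \<in> J" for j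
    using fact that js(2) by (auto simp: is_elem_factorization_def fs)
  have uniq: "j = k" if "j \<in> J" "k \<in> J" "fst j = Sp a 0" "fst k = Sp a 0" for j k a
  proof -
    have "a < n" using val[OF that(1)] that(3) by simp
    then have "length (filter (\<lambda>(x, s). s = Sp a 0) (map (\<lambda>j. (x j, fst j)) js)) \<le> 1"
      using fact unfolding is_elem_factorization_def fs by blast
    then have "card {j \<in> J. fst j = Sp a 0} \<le> Suc 0"
      by (simp only: length_filter_family[OF js(1)] js(2) One_nat_def)
    moreover have "finite {j \<in> J. fst j = Sp a 0}" using fin by simp
    ultimately have "\<forall>j\<in>{j \<in> J. fst j = Sp a 0}. \<forall>k\<in>{j \<in> J. fst j = Sp a 0}. j = k"
      by (subst (asm) card_le_Suc0_iff_eq)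
    then show ?thesis using that by blast
  qed
  have fam: "span_family n J x fst"
    unfolding span_family_def using fin val uniq by blast
  have "is_vec n (x' j) \<and> vec_has_span n (fst j) (x' j)" if "j \<in> J" for j
    using assms(4) that by (auto simp: J_def x'_def M_def)
  then have fam': "span_family n J x' fst"
    unfolding span_family_def using fin val uniq by blast
  have "trellis_equiv n T (elem_prod n (map (\<lambda>j. (x j, fst j)) js))"
    using fact unfolding is_elem_factorization_def fs by blast
  moreover have "trellis_equiv n (coord_trellis n J x fst) (elem_prod n (map (\<lambda>j. (x j, fst j)) js))"
    using coord_equiv_elem_prod[OF js(1)] js(2) by simp
  ultimately have Tx: "trellis_equiv n T (coord_trellis n J x fst)"
    by (rule trellis_equiv_trans[OF n_pos _ trellis_equiv_sym[OF n_pos]])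
  have C: "Cspan n T s = vec.span (x ` {j \<in> J. span_le n (fst j) s})" if "valid_span n s" for s
    using Cspan_eq_of_equiv_coord[OF n_pos linear edges_subset Tx] Cspan_coord[OF n_pos fam that] by simp
  let ?M' = "\<Sum>s\<in>set_mset M. mset (map (\<lambda>i. (alpha s i, s)) [1..<Suc (count M s)])"
  have "?M' = image_mset (\<lambda>j. (x' j, fst j)) (mset_set J)"
    unfolding J_def
    by (subst image_mset_Sigma) (simp_all add: x'_def atLeastLessThanSuc_atLeastAtMost del: upt_Suc)
  moreover have "mset (SOME fs. mset fs = ?M') = ?M'" by (rule someI_ex) (rule ex_mset)
  ultimately have "mset (SOME fs. mset fs = ?M') = image_mset (\<lambda>j. (x' j, fst j)) (mset_set J)"
    by (rule trans[rotated])
  from exists_enumeration[OF fin this] obtain js' where js': "distinct js'" "set js' = J"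
    "map (\<lambda>j. (x' j, fst j)) js' = (SOME fs. mset fs = ?M')" .
  have x'M: "trellis_equiv n (coord_trellis n J x' fst) (elem_prod_mset n ?M')"
    using coord_equiv_elem_prod[OF js'(1), of n x' fst] unfolding js'(2,3) elem_prod_mset_def .
  have "trellis_equiv n T (elem_prod_mset n ?M') \<longleftrightarrow> trellis_equiv n T (coord_trellis n J x' fst)"
    using trellis_equiv_trans[OF n_pos _ x'M] trellis_equiv_trans[OF n_pos _ trellis_equiv_sym[OF n_pos x'M]]
    by blast
  also have "\<dots> \<longleftrightarrow> (\<forall>j\<in>J. generates n J x' fst (Cspan n T) (fst j))"
  proof
    assume eq: "trellis_equiv n T (coord_trellis n J x' fst)"
    \<comment> \<open>Under the equivalence the spaces of \<open>T\<close> are generated by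
      \<open>x'\<close> itself, so the criterion becomes a statement about a single family.\<close>
    have "Cspan n T s = vec.span (x' ` {j \<in> J. span_le n (fst j) s})" if "valid_span n s" for s
      using Cspan_eq_of_equiv_coord[OF n_pos linear edges_subset eq] Cspan_coord[OF n_pos fam' that] by simp
    then show "\<forall>j\<in>J. generates n J x' fst (Cspan n T) (fst j)"
      using val by (auto intro!: generates_own_family[OF n_pos])
  next
    assume "\<forall>j\<in>J. generates n J x' fst (Cspan n T) (fst j)"
    then have "trellis_equiv n (coord_trellis n J x fst) (coord_trellis n J x' fst)"
      by (intro coord_equiv_of_generates[OF n_pos fam fam' C]) auto
    then show "trellis_equiv n T (coord_trellis n J x' fst)"
      using trellis_equiv_trans[OF n_pos Tx] by blast
  qed
  also have "\<dots> \<longleftrightarrow> (\<forall>s\<in>#M. generates n J x' fst (Cspan n T) s)"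
  proof -
    have "set_mset M = fst ` J"
      by (force simp: J_def Suc_le_eq)
    then show ?thesis by auto
  qed
  also have "\<dots> \<longleftrightarrow> (\<forall>s\<in>#M. Cspan n T s = set_plus_vec (gen_space (count M s) (alpha s)) (lower_sum n T s))"
  proof (rule ball_cong[OF refl])
    fix s assume s: "s \<in># M"
    have "x' ` {j \<in> J. fst j = s} = alpha s ` {1..count M s}"
      using s by (force simp: J_def x'_def)
    moreover have "lower_sum n T s =
        vec.span (\<Union>s'\<in>{s'. valid_span n s' \<and> span_less n s' s}. Cspan n T s')"
      by (rule lower_sum_eq_span) (simp add: C)
    ultimately show "generates n J x' fst (Cspan n T) s \<longleftrightarrow>
        Cspan n T s = set_plus_vec (gen_space (count M s) (alpha s)) (lower_sum n T s)"
      by (simp add: generates_def gen_space_eq_span set_plus_vec_span)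
  qed
  finally show ?thesis unfolding M_def .
qed

end
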